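(* Let $\mathcal N$ be a nerve in the labeled $n$-regular tree $\mathbb T_n$. Let $\mathcal R$ be a $\mathbb C$-algebra that is a Noetherian normal domain. Let $\mathcal E$ be a seed pattern of geometric type (with cluster and frozen variables in the fraction field of $\mathcal R$) satisfying: • all frozen variables are in $\mathcal R$; • for each vertex $t\in\mathcal N$, the cluster $\mathbf x(t)$ is contained in $\mathcal R$, and the cluster variables $x\in\mathbf x(t)$ are pairwise coprime elements of $\mathcal R$; • for each edge of $\mathcal N$ with label $k$ joining $t$ and $t'$, the cluster variables $x_k(t)$ and $x_k(t')$ are coprime. Then the cluster algebra $\mathcal A$ defined by $\mathcal E$ satisfies $\mathcal A\subset\mathcal R$.
   Context: $\mathbb T_n$ is the $n$-regular tree with edges labeled so that the edges at each vertex carry the labels $1,\dots,n$. A nerve is a connected subgraph of $\mathbb T_n$ in which every edge label $k\in\{1,\dots,n\}$ occurs at least once. Two elements of a domain are coprime if they are not contained in the same prime ideal of height $1$. A seed of geometric type of rank $n$ with frozen variables $x_{n+1},\dots,x_{n+m}$ consists of a cluster $\mathbf x=(x_1,\dots,x_n)$ and an $(n+m)\times n$ integer matrix $\tilde B=(b_{ij})$ with skew-symmetrizable top $n\times n$ part, where $x_1,\dots,x_{n+m}$ are algebraically independent. Mutation in direction $k$ replaces $\tilde B$ by $\tilde B'$ with $b'_{ij}=-b_{ij}$ if $i=k$ or $j=k$ and $b'_{ij}=b_{ij}+\mathrm{sign}(b_{ik})\max(b_{ik}b_{kj},0)$ otherwise, and replaces $x_k$ by $x_k'$ with $x_kx_k'=\prod_{i=1}^{n+m}x_i^{\max(b_{ik},0)}+\prod_{i=1}^{n+m}x_i^{\max(-b_{ik},0)}$,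 keeping the other variables. A seed pattern of geometric type $\mathcal E$ is a family of such seeds indexed by $t\in\mathbb T_n$, with clusters $\mathbf x(t)=(x_1(t),\dots,x_n(t))$ and common frozen variables, such that seeds across an edge labeled $k$ are related by mutation in direction $k$. The cluster algebra $\mathcal A$ is the algebra generated by the frozen variables and all cluster variables of all seeds of $\mathcal E$. *)

theory Defs
  imports
    "HOL-Algebra.Algebraic_Closure_Type"
    "HOL-Algebra.Ring_Divisibility"
    "HOL-Algebra.Generated_Rings"
    "HOL-Algebra.Module"
    "HOL-Library.Poly_Mapping"
    "HOL-Library.Extended_Nat"
begin

section \<open>The labeled regular tree and nerves\<close>

text \<open>An undirected simple graph is given by a set of vertices and a set of two-element edges.\<close>

definition simple_graph :: "'v set \<Rightarrow> 'v set set \<Rightarrow> bool" where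
  "simple_graph V E \<longleftrightarrow> (\<forall>e\<in>E. \<exists>u\<in>V. \<exists>v\<in>V. u \<noteq> v \<and> e = {u, v})"

definition connected_graph :: "'v set \<Rightarrow> 'v set set \<Rightarrow> bool" where
  "connected_graph V E \<longleftrightarrow>
     V \<noteq> {} \<and> (\<forall>u\<in>V. \<forall>v\<in>V. (u, v) \<in> {(a, b). {a, b} \<in> E}\<^sup>*)"

definition is_cycle :: "'v set set \<Rightarrow> 'v list \<Rightarrow> bool" where
  "is_cycle E p \<longleftrightarrow> length p \<ge> 3 \<and> distinct p \<and>
     (\<forall>i < length p. {p ! i, p ! (Suc i mod length p)} \<in> E)"

definition tree_graph :: "'v set \<Rightarrow> 'v set set \<Rightarrow> bool" where
  "tree_graph V E \<longleftrightarrow> simple_graph V E \<and> connected_graph V E \<and> (\<nexists>p. is_cycle E p)"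

text \<open>
  The bijection with \<open>{1..n}\<close> makes every vertex have degree \<open>n\<close>.  These conditions determine
  \<open>(V, E, lab)\<close> up to isomorphism.
\<close>

definition labeled_regular_tree :: "nat \<Rightarrow> 'v set \<Rightarrow> 'v set set \<Rightarrow> ('v set \<Rightarrow> nat) \<Rightarrow> bool" where
  "labeled_regular_tree n V E lab \<longleftrightarrow>
     tree_graph V E \<and> (\<forall>v\<in>V. bij_betw lab {e \<in> E. v \<in> e} {1..n})"

definition nerve ::
  "nat \<Rightarrow> 'v set \<Rightarrow> 'v set set \<Rightarrow> ('v set \<Rightarrow> nat) \<Rightarrow> 'v set \<Rightarrow> 'v set set \<Rightarrow> bool" where
  "nerve n V E lab W F \<longleftrightarrow>
     W \<subseteq> V \<and> F \<subseteq> E \<and> simple_graph W F \<and> connected_graph W F \<and> (\<forall>k\<in>{1..n}. \<exists>e\<in>F. lab e = k)"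

section \<open>The ring\<close>

text \<open>
  The domain \<open>R\<close> is a subset of an ambient field, given by the type \<open>'k\<close>, whose operations it
  inherits; \<open>sc\<close> is the scalar multiplication of \<open>R\<close> and is only meaningful on \<open>R\<close>.
\<close>

definition alg_of :: "'k::field set \<Rightarrow> (complex \<Rightarrow> 'k \<Rightarrow> 'k) \<Rightarrow> (complex, 'k) module" where
  "alg_of R sc =
     \<lparr>carrier = R, monoid.mult = (*), one = 1, ring.zero = 0, add = (+), module.smult = sc\<rparr>"

definition is_fraction_field_of :: "'k::field set \<Rightarrow> bool" where
  "is_fraction_field_of R \<longleftrightarrow> (\<forall>x. \<exists>a\<in>R. \<exists>b\<in>R. b \<noteq> 0 \<and> x = a / b)"

definition integral_over :: "'k::field set \<Rightarrow> 'k \<Rightarrow> bool" where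
  "integral_over R x \<longleftrightarrow> (\<exists>p. lead_coeff p = 1 \<and> (\<forall>i. coeff p i \<in> R) \<and> poly p x = 0)"

text \<open>Integrally closed in \<open>'k\<close>; this is normality when \<open>'k\<close> is the fraction field of \<open>R\<close>.\<close>

definition integrally_closed :: "'k::field set \<Rightarrow> bool" where
  "integrally_closed R \<longleftrightarrow> (\<forall>x. integral_over R x \<longrightarrow> x \<in> R)"

definition noetherian_normal_domain_algebra ::
    "'k::field set \<Rightarrow> (complex \<Rightarrow> 'k \<Rightarrow> 'k) \<Rightarrow> bool" where
  "noetherian_normal_domain_algebra R sc \<longleftrightarrow>
     algebra (ring_of_type_algebra :: complex ring) (alg_of R sc) \<and>
     noetherian_domain (alg_of R sc) \<and>
     is_fraction_field_of R \<and> integrally_closed R"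

definition prime_height :: "('a, 'b) ring_scheme \<Rightarrow> 'a set \<Rightarrow> enat" where
  "prime_height A P =
     (SUP l \<in> {l. \<exists>Q :: nat \<Rightarrow> 'a set. (\<forall>i\<le>l. primeideal (Q i) A) \<and>
                    (\<forall>i<l. Q i \<subset> Q (Suc i)) \<and> Q l = P}. enat l)"

definition coprime_in :: "('a, 'b) ring_scheme \<Rightarrow> 'a \<Rightarrow> 'a \<Rightarrow> bool" where
  "coprime_in A a b \<longleftrightarrow> \<not> (\<exists>P. primeideal P A \<and> prime_height A P = 1 \<and> a \<in> P \<and> b \<in> P)"

section \<open>Algebraic independence\<close>

text \<open>
  A polynomial in variables indexed by \<open>nat\<close> is a finitely supported map from monomials to
  coefficients, a monomial being a finitely supported map from variables to exponents.
  The complex number \<open>c\<close> is the element \<open>sc c 1\<close> of the ambient field.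
\<close>

definition eval_mpoly ::
    "(complex \<Rightarrow> 'k::field \<Rightarrow> 'k) \<Rightarrow> (nat \<Rightarrow> 'k) \<Rightarrow> ((nat \<Rightarrow>\<^sub>0 nat) \<Rightarrow>\<^sub>0 complex) \<Rightarrow> 'k" where
  "eval_mpoly sc x p =
     (\<Sum>u\<in>Poly_Mapping.keys p. sc (Poly_Mapping.lookup p u) 1 *
        (\<Prod>i\<in>Poly_Mapping.keys u. x i ^ Poly_Mapping.lookup u i))"

definition alg_independent ::
    "(complex \<Rightarrow> 'k::field \<Rightarrow> 'k) \<Rightarrow> nat set \<Rightarrow> (nat \<Rightarrow> 'k) \<Rightarrow> bool" where
  "alg_independent sc I x \<longleftrightarrow>
     (\<forall>p. (\<forall>u\<in>Poly_Mapping.keys p. Poly_Mapping.keys u \<subseteq> I) \<longrightarrow> eval_mpoly sc x p = 0 \<longrightarrow> p = 0)"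

section \<open>Seeds, seed patterns and cluster algebras\<close>

text \<open>
  The variables with index in \<open>{1..n}\<close> form the cluster, those with index in \<open>{n+1..n+m}\<close> are
  frozen.  Matrix entries are relevant only for rows in \<open>{1..n+m}\<close> and columns in \<open>{1..n}\<close>.
\<close>

record 'k seed =
  xvar :: "nat \<Rightarrow> 'k"
  bmat :: "nat \<Rightarrow> nat \<Rightarrow> int"

definition skew_symmetrizable :: "nat \<Rightarrow> (nat \<Rightarrow> nat \<Rightarrow> int) \<Rightarrow> bool" where
  "skew_symmetrizable n b \<longleftrightarrow>
     (\<exists>d :: nat \<Rightarrow> int. (\<forall>i\<in>{1..n}. d i > 0) \<and>
        (\<forall>i\<in>{1..n}. \<forall>j\<in>{1..n}. d i * b i j = - (d j * b j i)))"

definition is_seed :: "(complex \<Rightarrow> 'k::field \<Rightarrow> 'k) \<Rightarrow> nat \<Rightarrow> nat \<Rightarrow> 'k seed \<Rightarrow> bool" where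
  "is_seed sc n m S \<longleftrightarrow>
     skew_symmetrizable n (bmat S) \<and> alg_independent sc {1..n+m} (xvar S)"

definition mutated_entry :: "(nat \<Rightarrow> nat \<Rightarrow> int) \<Rightarrow> nat \<Rightarrow> nat \<Rightarrow> nat \<Rightarrow> int" where
  "mutated_entry b k i j =
     (if i = k \<or> j = k then - b i j else b i j + sgn (b i k) * max (b i k * b k j) 0)"

definition seed_mutation :: "nat \<Rightarrow> nat \<Rightarrow> nat \<Rightarrow> 'k::field seed \<Rightarrow> 'k seed \<Rightarrow> bool" where
  "seed_mutation n m k S S' \<longleftrightarrow>
     (\<forall>i\<in>{1..n+m}. \<forall>j\<in>{1..n}. bmat S' i j = mutated_entry (bmat S) k i j) \<and>
     (\<forall>i\<in>{1..n+m}. i \<noteq> k \<longrightarrow> xvar S' i = xvar S i) \<and>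
     xvar S k * xvar S' k =
       (\<Prod>i\<in>{1..n+m}. xvar S i ^ nat (max (bmat S i k) 0)) +
       (\<Prod>i\<in>{1..n+m}. xvar S i ^ nat (max (- bmat S i k) 0))"

definition seed_pattern ::
    "(complex \<Rightarrow> 'k::field \<Rightarrow> 'k) \<Rightarrow> nat \<Rightarrow> nat \<Rightarrow> 'v set \<Rightarrow> 'v set set \<Rightarrow> ('v set \<Rightarrow> nat) \<Rightarrow>
       ('v \<Rightarrow> 'k seed) \<Rightarrow> bool" where
  "seed_pattern sc n m V E lab S \<longleftrightarrow>
     (\<forall>t\<in>V. is_seed sc n m (S t)) \<and>
     (\<forall>t\<in>V. \<forall>t'\<in>V. \<forall>i\<in>{n+1..n+m}. xvar (S t) i = xvar (S t') i) \<and>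
     (\<forall>t\<in>V. \<forall>t'\<in>V. {t, t'} \<in> E \<longrightarrow> seed_mutation n m (lab {t, t'}) (S t) (S t'))"

definition frozen_vars :: "nat \<Rightarrow> nat \<Rightarrow> 'v set \<Rightarrow> ('v \<Rightarrow> 'k seed) \<Rightarrow> 'k set" where
  "frozen_vars n m V S = {xvar (S t) i | t i. t \<in> V \<and> i \<in> {n+1..n+m}}"

definition cluster :: "nat \<Rightarrow> 'k seed \<Rightarrow> 'k set" where
  "cluster n S = xvar S ` {1..n}"

text \<open>
  The complex subalgebra of the ambient field generated by the frozen and the cluster variables,
  i.e. the subring generated by these and the complex constants.
\<close>

definition cluster_algebra ::
    "(complex \<Rightarrow> 'k::field \<Rightarrow> 'k) \<Rightarrow> nat \<Rightarrow> nat \<Rightarrow> 'v set \<Rightarrow> ('v \<Rightarrow> 'k seed) \<Rightarrow> 'k set" where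
  "cluster_algebra sc n m V S =
     generate_ring (ring_of_type_algebra :: 'k ring)
       (range (\<lambda>c. sc c 1) \<union> frozen_vars n m V S \<union> (\<Union>t\<in>V. cluster n (S t)))"

end

theory Submission
  imports Defs "HOL-Computational_Algebra.Polynomial_Factorial"
begin

text \<open>
  Let \<open>y\<close> be a cluster variable outside \<open>R\<close>. Among the denominator ideals
  \<open>{s. s r y \<in> R}\<close> of the multiples \<open>r y \<notin> R\<close> a maximal one \<open>P\<close> is prime, and normality forces it
  to have height 1. Coprimality along the nerve produces a vertex \<open>t\<close> none of whose cluster
  variables lies in \<open>P\<close>. By the Laurent phenomenon some power of the product of the variables of
  \<open>\<^bold>x(t)\<close> multiplies \<open>y\<close> into \<open>R\<close>, hence lies in \<open>P\<close>, a contradiction.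

  The Laurent phenomenon is needed in its strong form, where frozen variables are not inverted.
  It is proved by induction on the length of a mutation path starting with the directions
  \<open>j, k\<close>: by induction \<open>y\<close> is Laurent in the cluster after \<open>j\<close> and in the cluster after \<open>j, k, j\<close>,
  so that powers of \<open>p\<close> and of \<open>q r\<close> multiply \<open>y\<close> to a Laurent polynomial, where \<open>p\<close> is the new
  variable of the first cluster and \<open>q, r\<close> are those of the second one. An additional frozen variable
  \<open>z\<close> that occurs only in column \<open>j\<close> makes \<open>p\<close> a unit multiple of \<open>z - w\<close> with \<open>w\<close> a unit free of \<open>z\<close>,
  so that substituting \<open>w\<close> for \<open>z\<close> is a homomorphism to a domain with kernel generated by \<open>p\<close>;
  it does not kill \<open>q r\<close>. Frozen denominators are excluded because an exchange binomial is not
  divisible by any frozen variable.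
\<close>

section \<open>Evaluation of Laurent polynomials\<close>

text \<open>Exchange relations have integer coefficients, so integer Laurent polynomials can record
  cluster variables and can be evaluated in every field.\<close>

type_synonym laurent = "(nat \<Rightarrow>\<^sub>0 int) \<Rightarrow>\<^sub>0 int"

definition mon_eval :: "(nat \<Rightarrow> 'k::field) \<Rightarrow> (nat \<Rightarrow>\<^sub>0 int) \<Rightarrow> 'k" where
  "mon_eval x e = (\<Prod>i\<in>Poly_Mapping.keys e. x i powi Poly_Mapping.lookup e i)"

definition laurent_eval :: "(nat \<Rightarrow> 'k::field) \<Rightarrow> laurent \<Rightarrow> 'k" where
  "laurent_eval x G = (\<Sum>e\<in>Poly_Mapping.keys G. of_int (Poly_Mapping.lookup G e) * mon_eval x e)"

lemma poly_mapping_sum_single: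
  "(\<Sum>e\<in>Poly_Mapping.keys G. Poly_Mapping.single e (Poly_Mapping.lookup G e)) = G"
  by (rule poly_mapping_eqI)
    (auto simp: lookup_sum lookup_single when_def in_keys_iff)

lemma mon_eval_superset:
  assumes "finite A" "Poly_Mapping.keys e \<subseteq> A"
  shows "mon_eval x e = (\<Prod>i\<in>A. x i powi Poly_Mapping.lookup e i)"
  unfolding mon_eval_def
  by (rule prod.mono_neutral_left) (use assms in \<open>auto simp: in_keys_iff\<close>)

lemma mon_eval_0 [simp]: "mon_eval x 0 = 1"
  by (simp add: mon_eval_def)

text \<open>At a zero coordinate the powers with exponents 1 and -1 would multiply to 0 instead of
  1; hence all coordinates are taken nonzero.\<close>

lemma mon_eval_add:
  assumes "\<And>i. x i \<noteq> 0"
  shows "mon_eval x (e + e') = mon_eval x e * mon_eval x e'"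
proof -
  let ?A = "Poly_Mapping.keys e \<union> Poly_Mapping.keys e'"
  have "mon_eval x (e + e') = (\<Prod>i\<in>?A. x i powi Poly_Mapping.lookup (e + e') i)"
    by (rule mon_eval_superset) (use keys_add[of e e'] in auto)
  also have "\<dots> = (\<Prod>i\<in>?A. x i powi Poly_Mapping.lookup e i) * (\<Prod>i\<in>?A. x i powi Poly_Mapping.lookup e' i)"
    by (simp add: lookup_add power_int_add assms prod.distrib)
  also have "\<dots> = mon_eval x e * mon_eval x e'"
    by (simp add: mon_eval_superset[of ?A])
  finally show ?thesis .
qed

lemma mon_eval_single [simp]: "mon_eval x (Poly_Mapping.single i a) = x i powi a"
  by (cases "a = 0") (auto simp: mon_eval_def)

lemma laurent_eval_superset:
  assumes "finite A" "Poly_Mapping.keys G \<subseteq> A"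
  shows "laurent_eval x G = (\<Sum>e\<in>A. of_int (Poly_Mapping.lookup G e) * mon_eval x e)"
  unfolding laurent_eval_def
  by (rule sum.mono_neutral_left) (use assms in \<open>auto simp: in_keys_iff\<close>)

lemma laurent_eval_single [simp]: 
  "laurent_eval x (Poly_Mapping.single e c) = of_int c * mon_eval x e"
  by (cases "c = 0") (auto simp: laurent_eval_def)

lemma laurent_eval_0 [simp]: "laurent_eval x 0 = 0"
  by (simp add: laurent_eval_def)

lemma laurent_eval_1 [simp]: "laurent_eval x 1 = 1"
  by (simp add: laurent_eval_def lookup_one when_def)

lemma laurent_eval_add [simp]: "laurent_eval x (G + H) = laurent_eval x G + laurent_eval x H"
proof -
  let ?A = "Poly_Mapping.keys G \<union> Poly_Mapping.keys H"
  have "laurent_eval x (G + H) = (\<Sum>e\<in>?A. of_int (Poly_Mapping.lookup (G + H) e) * mon_eval x e)"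
    by (rule laurent_eval_superset) (use keys_add[of G H] in auto)
  also have "\<dots> = laurent_eval x G + laurent_eval x H"
    by (simp add: lookup_add algebra_simps sum.distrib laurent_eval_superset[of ?A])
  finally show ?thesis .
qed

lemma laurent_eval_uminus [simp]: "laurent_eval x (- G) = - laurent_eval x G"
  using laurent_eval_add[of x G "- G"] by (simp add: eq_neg_iff_add_eq_0 add.commute)

lemma laurent_eval_diff [simp]: "laurent_eval x (G - H) = laurent_eval x G - laurent_eval x H"
  using laurent_eval_add[of x G "- H"] by simp

lemma laurent_eval_sum: "laurent_eval x (\<Sum>i\<in>A. f i) = (\<Sum>i\<in>A. laurent_eval x (f i))"
  by (induction A rule: infinite_finite_induct) auto

context
  fixes x :: "nat \<Rightarrow> 'k::field"
  assumes nz: "\<And>i. x i \<noteq> 0"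
begin

lemma laurent_eval_mult: "laurent_eval x (G * H) = laurent_eval x G * laurent_eval x H"
proof -
  let ?s = "\<lambda>G e. Poly_Mapping.single e (Poly_Mapping.lookup G e)"
  have "G * H = (\<Sum>e\<in>Poly_Mapping.keys G. ?s G e) * (\<Sum>e\<in>Poly_Mapping.keys H. ?s H e)"
    by (simp add: poly_mapping_sum_single)
  also have "\<dots> = (\<Sum>e\<in>Poly_Mapping.keys G. \<Sum>e'\<in>Poly_Mapping.keys H. ?s G e * ?s H e')"
    by (rule sum_product)
  finally have "laurent_eval x (G * H) =
      (\<Sum>e\<in>Poly_Mapping.keys G. \<Sum>e'\<in>Poly_Mapping.keys H. laurent_eval x (?s G e) * laurent_eval x (?s H e'))"
    by (simp add: laurent_eval_sum mult_single mon_eval_add nz mult_ac)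
  then show ?thesis
    unfolding laurent_eval_single laurent_eval_def[of x G] laurent_eval_def[of x H] sum_product .
qed

lemma laurent_eval_power: "laurent_eval x (G ^ n) = laurent_eval x G ^ n"
  by (induction n) (auto simp: laurent_eval_mult)

lemma laurent_eval_prod: "laurent_eval x (\<Prod>i\<in>A. f i) = (\<Prod>i\<in>A. laurent_eval x (f i))"
  by (induction A rule: infinite_finite_induct) (auto simp: laurent_eval_mult)

end

section \<open>The Laurent polynomial ring inside its fraction field\<close>

definition lvar :: "nat \<Rightarrow> laurent" where
  "lvar i = Poly_Mapping.single (Poly_Mapping.single i 1) 1"

definition linv :: "nat \<Rightarrow> laurent" where
  "linv i = Poly_Mapping.single (Poly_Mapping.single i (-1)) 1"

lemma lvar_linv [simp]: "lvar i * linv i = 1" "linv i * lvar i = 1"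
  by (auto simp: lvar_def linv_def mult_single simp flip: single_add)

lemma lvar_nonzero [simp]: "lvar i \<noteq> 0"
  by (metis lvar_linv(1) mult_zero_left zero_neq_one)

lemma laurent_eval_lvar [simp]: "laurent_eval x (lvar i) = x i"
  by (simp add: lvar_def)

abbreviation lfr :: "laurent \<Rightarrow> laurent fract" where
  "lfr \<equiv> to_fract"

lemma to_fract_power: "to_fract (a ^ n) = to_fract a ^ n"
  by (induction n) auto

lemma to_fract_sum: "to_fract (\<Sum>i\<in>A. f i) = (\<Sum>i\<in>A. to_fract (f i))"
  by (induction A rule: infinite_finite_induct) auto

lemma to_fract_prod: "to_fract (\<Prod>i\<in>A. f i) = (\<Prod>i\<in>A. to_fract (f i))"
  by (induction A rule: infinite_finite_induct) auto

lemma lfr_linv: "lfr (linv i) = inverse (lfr (lvar i))"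
  by (metis inverse_unique lvar_linv(1) to_fract_1 to_fract_mult)

lemma to_fract_of_nat: "to_fract (of_nat n) = of_nat n"
  by (simp add: of_nat_fract to_fract_def)

lemma to_fract_of_int: "to_fract (of_int n) = of_int n"
  by (cases n rule: int_cases2) (auto simp: to_fract_of_nat)

lemma lfr_powi_lvar: "lfr (Poly_Mapping.single (Poly_Mapping.single i a) 1) = lfr (lvar i) powi a"
proof -
  have *: "lfr (Poly_Mapping.single (Poly_Mapping.single i (int n)) 1) = lfr (lvar i) ^ n" for n
  proof (induction n)
    case (Suc n)
    have "Poly_Mapping.single (Poly_Mapping.single i (int (Suc n))) 1 = 
         lvar i * Poly_Mapping.single (Poly_Mapping.single i (int n)) 1"
      by (simp add: lvar_def mult_single flip: single_add)
    then show ?case using Suc by simp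
  qed auto
  show ?thesis
  proof (cases a rule: int_cases2)
    case (nonneg n)
    then show ?thesis by (simp add: *)
  next
    case (nonpos n)
    have "Poly_Mapping.single (Poly_Mapping.single i (int n)) 1 *
       Poly_Mapping.single (Poly_Mapping.single i (- int n)) (1::int) = 1"
      by (simp add: mult_single flip: single_add)
    then have "lfr (lvar i) ^ n * lfr (Poly_Mapping.single (Poly_Mapping.single i (- int n)) 1) = 1"
      by (metis * to_fract_1 to_fract_mult)
    then show ?thesis
      by (simp add: nonpos power_int_minus inverse_unique)
  qed
qed

lemma lfr_mon: "lfr (Poly_Mapping.single e 1) = mon_eval (\<lambda>i. lfr (lvar i)) e"
proof -
  have "Poly_Mapping.single e (1::int) = 
     (\<Prod>i\<in>Poly_Mapping.keys e. Poly_Mapping.single (Poly_Mapping.single i (Poly_Mapping.lookup e i)) 1)"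
  proof -
    have "finite A \<Longrightarrow> (\<Prod>i\<in>A. Poly_Mapping.single (f i) (1::int)) = Poly_Mapping.single (\<Sum>i\<in>A. f i) 1"
      for A :: "nat set" and f :: "nat \<Rightarrow> (nat \<Rightarrow>\<^sub>0 int)"
      by (induction A rule: finite_induct) (auto simp: mult_single)
    then show ?thesis
      by (simp add: poly_mapping_sum_single)
  qed
  then show ?thesis
    by (simp only: to_fract_prod lfr_powi_lvar mon_eval_def)
qed

text \<open>The point \<open>\<lambda>i. lfr (lvar i)\<close> is the generic point. Evaluation there
  is the embedding itself, so a statement about evaluations can be read back as one about Laurent
  polynomials.\<close>

lemma laurent_eval_lfr: "laurent_eval (\<lambda>i. lfr (lvar i)) G = lfr G"
proof -
  have "Poly_Mapping.single e c = of_int c * Poly_Mapping.single e 1" for e :: "nat \<Rightarrow>\<^sub>0 int" and c :: int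
    by (simp add: mult_single flip: single_of_int)
  then have "lfr (Poly_Mapping.single e c) = of_int c * lfr (Poly_Mapping.single e 1)" for e c
    by (metis to_fract_mult to_fract_of_int)
  then have "lfr (Poly_Mapping.single e c) = of_int c * mon_eval (\<lambda>i. lfr (lvar i)) e" for e c
    by (simp add: lfr_mon)
  then have "lfr (\<Sum>e\<in>Poly_Mapping.keys G. Poly_Mapping.single e (Poly_Mapping.lookup G e)) = 
     laurent_eval (\<lambda>i. lfr (lvar i)) G"
    by (simp only: to_fract_sum laurent_eval_def)
  then show ?thesis
    by (simp only: poly_mapping_sum_single)
qed

section \<open>Iterated mutation\<close>

text \<open>\<open>nat\<close> truncates negative entries, so the two products collect the positive
  and the negative entries of column \<open>k\<close>. Any commutative ring is allowed, so that the
  formula applies to Laurent polynomials as well as to their values.\<close>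

definition exchange_binomial :: "nat \<Rightarrow> (nat \<Rightarrow> nat \<Rightarrow> int) \<Rightarrow> nat \<Rightarrow> (nat \<Rightarrow> 'a::comm_ring_1) \<Rightarrow> 'a" where
  "exchange_binomial N b k x = (\<Prod>i\<in>{1..N}. x i ^ nat (b i k)) + (\<Prod>i\<in>{1..N}. x i ^ nat (- b i k))"

definition mutated_vars :: "nat \<Rightarrow> (nat \<Rightarrow> nat \<Rightarrow> int) \<Rightarrow> nat \<Rightarrow> (nat \<Rightarrow> 'k::field) \<Rightarrow> nat \<Rightarrow> 'k" where
  "mutated_vars N b k x = x(k := exchange_binomial N b k x / x k)"

fun vars_along :: "nat \<Rightarrow> (nat \<Rightarrow> nat \<Rightarrow> int) \<Rightarrow> (nat \<Rightarrow> 'k::field) \<Rightarrow> nat list \<Rightarrow> nat \<Rightarrow> 'k" where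
  "vars_along N b x [] = x"
| "vars_along N b x (k # ks) = vars_along N (mutated_entry b k) (mutated_vars N b k x) ks"

fun matrix_along :: "(nat \<Rightarrow> nat \<Rightarrow> int) \<Rightarrow> nat list \<Rightarrow> nat \<Rightarrow> nat \<Rightarrow> int" where
  "matrix_along b [] = b"
| "matrix_along b (k # ks) = matrix_along (mutated_entry b k) ks"

lemma vars_along_snoc: "vars_along N b x (ks @ [k]) =
    mutated_vars N (matrix_along b ks) k (vars_along N b x ks)"
  by (induction ks arbitrary: b x) auto

lemma matrix_along_snoc: "matrix_along b (ks @ [k]) = mutated_entry (matrix_along b ks) k"
  by (induction ks arbitrary: b) auto

lemma exchange_binomial_cong:
  assumes "\<And>i. i \<in> {1..N} \<Longrightarrow> b i k = b' i k" "\<And>i. i \<in> {1..N} \<Longrightarrow> b i k \<noteq> 0 \<Longrightarrow> x i = x' i"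
  shows "exchange_binomial N b k x = exchange_binomial N b' k x'"
proof -
  have "(\<Prod>i\<in>{1..N}. x i ^ nat (b i k)) = (\<Prod>i\<in>{1..N}. x' i ^ nat (b' i k))"
       "(\<Prod>i\<in>{1..N}. x i ^ nat (- b i k)) = (\<Prod>i\<in>{1..N}. x' i ^ nat (- b' i k))"
    by (rule prod.cong; use assms in \<open>force\<close>)+
  then show ?thesis
    by (simp add: exchange_binomial_def)
qed

lemma laurent_eval_exchange_binomial:
  assumes "\<And>i. x i \<noteq> 0"
  shows "laurent_eval x (exchange_binomial N b k g) = exchange_binomial N b k (\<lambda>i. laurent_eval x (g i))"
  by (simp add: exchange_binomial_def laurent_eval_prod laurent_eval_power assms)

lemma to_fract_exchange_binomial:
    "to_fract (exchange_binomial N b k g) = exchange_binomial N b k (\<lambda>i. to_fract (g i))"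
  by (simp add: exchange_binomial_def to_fract_prod to_fract_power)

section \<open>Skew-symmetrizable matrices and the involutivity of mutation\<close>

lemma skew_symmetrizable_sgn:
  assumes "skew_symmetrizable n b" "j \<in> {1..n}" "k \<in> {1..n}"
  shows "sgn (b j k) = - sgn (b k j)"
proof -
  obtain d :: "nat \<Rightarrow> int" where d: "d j > 0" "d k > 0" "d j * b j k = - (d k * b k j)"
    using assms unfolding skew_symmetrizable_def by blast
  have "sgn (d j * b j k) = sgn (- (d k * b k j))"
    using d(3) by simp
  then show ?thesis
    using d(1,2) by (simp add: sgn_mult sgn_minus)
qed

lemma skew_symmetrizable_diag:
  assumes "skew_symmetrizable n b" "k \<in> {1..n}"
  shows "b k k = 0"
  using skew_symmetrizable_sgn[OF assms(1,2,2)] by (simp add: sgn_if split: if_splits)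

text \<open>The symmetrizer \<open>d\<close> is kept. Scaled by \<open>d i\<close> and
  \<open>d j\<close>, the products \<open>b i k * b k j\<close> and \<open>b j k * b k i\<close>
  agree, and when they are positive the signs of \<open>b i k\<close> and \<open>b j k\<close> are
  opposite, so the correction terms are skew too.\<close>

lemma skew_symmetrizable_mutated_entry:
  assumes "skew_symmetrizable n b" "k \<in> {1..n}"
  shows "skew_symmetrizable n (mutated_entry b k)"
proof -
  obtain d :: "nat \<Rightarrow> int" where d_pos: "\<And>i. i \<in> {1..n} \<Longrightarrow> d i > 0"
    and d: "\<And>i j. i \<in> {1..n} \<Longrightarrow> j \<in> {1..n} \<Longrightarrow> d i * b i j = - (d j * b j i)"
    using assms unfolding skew_symmetrizable_def by blast
  have "d i * mutated_entry b k i j = - (d j * mutated_entry b k j i)"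
    if ij: "i \<in> {1..n}" "j \<in> {1..n}" for i j
  proof (cases "i = k \<or> j = k")
    case True
    then show ?thesis
      using d[OF ij] by (auto simp: mutated_entry_def)
  next
    case False
    have s: "sgn (b i k) = - sgn (b k i)" "sgn (b k j) = - sgn (b j k)"
      using skew_symmetrizable_sgn[OF assms(1)] ij assms(2) by blast+
    have *: "d i * (b i k * b k j) = d j * (b j k * b k i)"
    proof -
      have "d i * (b i k * b k j) = (d i * b i k) * b k j"
        by simp
      also have "\<dots> = - (d k * b k j) * b k i"
        unfolding d[OF ij(1) assms(2)] by simp
      also have "- (d k * b k j) = d j * b j k"
        using d[OF ij(2) assms(2)] by simp
      finally show ?thesis
        by (simp add: algebra_simps)
    qed
    have "sgn (b i k * b k j) = sgn (b j k * b k i)"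
      by (simp add: sgn_mult s mult.commute)
    moreover have "sgn (b i k) = - sgn (b j k)" if "b i k * b k j > 0"
      using that s by (auto simp: zero_less_mult_iff sgn_if split: if_splits)
    ultimately have "d i * (sgn (b i k) * max (b i k * b k j) 0) =
        - (d j * (sgn (b j k) * max (b j k * b k i) 0))"
      using * by (auto simp: max_def sgn_if split: if_splits)
    then show ?thesis
      using d[OF ij] False by (simp add: mutated_entry_def distrib_left)
  qed
  then show ?thesis
    using d_pos unfolding skew_symmetrizable_def by blast
qed

lemma mutated_entry_involution [simp]: "mutated_entry (mutated_entry b k) k = b"
  by (intro ext) (simp add: mutated_entry_def sgn_minus)

lemma mutated_entry_uminus: "mutated_entry (\<lambda>i j. - b i j) k = (\<lambda>i j. - mutated_entry b k i j)"
  by (intro ext) (simp add: mutated_entry_def sgn_minus)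

lemma exchange_binomial_uminus: "exchange_binomial N (\<lambda>i j. - b i j) k x = exchange_binomial N b k x"
  by (simp add: exchange_binomial_def add.commute)

text \<open>Changing all signs merely swaps the two monomials of each exchange binomial. This later
  allows one matrix entry to be assumed nonnegative.\<close>

lemma vars_along_uminus: "vars_along N (\<lambda>i j. - b i j) x ks = vars_along N b x ks"
proof (induction ks arbitrary: b x)
  case (Cons k ks)
  show ?case
    unfolding vars_along.simps mutated_entry_uminus mutated_vars_def exchange_binomial_uminus by (rule Cons.IH)
qed simp

lemma skew_symmetrizable_uminus: "skew_symmetrizable n b \<Longrightarrow> skew_symmetrizable n (\<lambda>i j. - b i j)"
  unfolding skew_symmetrizable_def by (metis minus_mult_right)

text \<open>As \<open>b k k = 0\<close>, the binomial in direction \<open>k\<close> is free of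
  \<open>x k\<close>. Mutation negates column \<open>k\<close>, which swaps the monomials, so the
  way back uses the same binomial.\<close>

lemma mutated_vars_involution:
  assumes "b k k = 0" "x k \<noteq> 0" "exchange_binomial N b k x \<noteq> 0"
  shows "mutated_vars N (mutated_entry b k) k (mutated_vars N b k x) = x"
proof -
  have "exchange_binomial N (mutated_entry b k) k (mutated_vars N b k x) =
      exchange_binomial N (\<lambda>i j. - b i j) k x"
    by (rule exchange_binomial_cong) (use assms in \<open>auto simp: mutated_entry_def mutated_vars_def\<close>)
  then show ?thesis
    using assms by (simp add: mutated_vars_def exchange_binomial_uminus)
qed

text \<open>The case \<open>N' = Suc N\<close> specializes an additional frozen variable to 1.\<close>

lemma vars_along_cong:
  assumes "n \<le> N" "set ks \<subseteq> {1..n}" "N' = N \<or> N' = Suc N \<and> x' (Suc N) = 1"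
    and "\<And>i j. i \<in> {1..N} \<Longrightarrow> j \<in> {1..n} \<Longrightarrow> b' i j = b i j"
    and "\<And>i. i \<in> {1..N} \<Longrightarrow> x' i = x i" and "i \<in> {1..N}"
  shows "vars_along N' b' x' ks i = vars_along N b x ks i"
  using assms
proof (induction ks arbitrary: b b' x x')
  case (Cons k ks)
  have k: "k \<in> {1..n}" "k \<in> {1..N}" "k \<noteq> Suc N"
    using Cons.prems by auto
  have "exchange_binomial N' b' k x' = exchange_binomial N b' k x'"
    using Cons.prems(3) by (auto simp: exchange_binomial_def prod.nat_ivl_Suc')
  also have "\<dots> = exchange_binomial N b k x"
    by (rule exchange_binomial_cong) (use Cons.prems k in auto)
  finally have e: "exchange_binomial N' b' k x' = exchange_binomial N b k x" .
  have "vars_along N' (mutated_entry b' k) (mutated_vars N' b' k x') ks i =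
      vars_along N (mutated_entry b k) (mutated_vars N b k x) ks i"
  proof (rule Cons.IH)
    show "mutated_entry b' k i j = mutated_entry b k i j" if "i \<in> {1..N}" "j \<in> {1..n}" for i j
      using Cons.prems(4)[OF that] Cons.prems(4)[OF that(1) k(1)] Cons.prems(4)[OF k(2) that(2)]
      by (simp add: mutated_entry_def)
    show "mutated_vars N' b' k x' i = mutated_vars N b k x i" if "i \<in> {1..N}" for i
      using Cons.prems(5) that k by (simp add: mutated_vars_def e)
    show "N' = N \<or> N' = Suc N \<and> mutated_vars N' b' k x' (Suc N) = 1"
      using Cons.prems(3) k by (auto simp: mutated_vars_def)
  qed (use Cons.prems in auto)
  then show ?case by simp
qed auto

text \<open>Positivity is measured after specializing all variables to 1, which keeps the exchange
  binomials away from zero.\<close>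

definition positive_at_1 :: "laurent fract \<Rightarrow> bool" where
  "positive_at_1 a \<longleftrightarrow>
      (\<exists>P Q. a = lfr P / lfr Q \<and> laurent_eval (\<lambda>_. 1::rat) P > 0 \<and> laurent_eval (\<lambda>_. 1::rat) Q > 0)"

lemma positive_at_1_nonzero: "positive_at_1 a \<Longrightarrow> a \<noteq> 0"
  by (auto simp: positive_at_1_def)

lemma positive_at_1_mult: "positive_at_1 a \<Longrightarrow> positive_at_1 c \<Longrightarrow> positive_at_1 (a * c)"
  unfolding positive_at_1_def
proof clarify
  fix P Q P' Q' :: laurent
  assume "laurent_eval (\<lambda>_. 1::rat) P > 0" "laurent_eval (\<lambda>_. 1::rat) Q > 0"
    "laurent_eval (\<lambda>_. 1::rat) P' > 0" "laurent_eval (\<lambda>_. 1::rat) Q' > 0"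
  then show "\<exists>R S. lfr P / lfr Q * (lfr P' / lfr Q') = lfr R / lfr S \<and>
      laurent_eval (\<lambda>_. 1::rat) R > 0 \<and> laurent_eval (\<lambda>_. 1::rat) S > 0"
    by (intro exI[of _ "P * P'"] exI[of _ "Q * Q'"]) (simp add: laurent_eval_mult)
qed

lemma positive_at_1_add: "positive_at_1 a \<Longrightarrow> positive_at_1 c \<Longrightarrow> positive_at_1 (a + c)"
  unfolding positive_at_1_def
proof clarify
  fix P Q P' Q' :: laurent
  assume *: "laurent_eval (\<lambda>_. 1::rat) P > 0" "laurent_eval (\<lambda>_. 1::rat) Q > 0"
    "laurent_eval (\<lambda>_. 1::rat) P' > 0" "laurent_eval (\<lambda>_. 1::rat) Q' > 0"
  then have "Q \<noteq> 0" "Q' \<noteq> 0" by auto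
  with * show "\<exists>R S. lfr P / lfr Q + lfr P' / lfr Q' = lfr R / lfr S \<and>
      laurent_eval (\<lambda>_. 1::rat) R > 0 \<and> laurent_eval (\<lambda>_. 1::rat) S > 0"
    by (intro exI[of _ "P * Q' + P' * Q"] exI[of _ "Q * Q'"])
      (simp add: laurent_eval_mult add_frac_eq add_pos_pos)
qed

lemma positive_at_1_inverse: "positive_at_1 a \<Longrightarrow> positive_at_1 (inverse a)"
  unfolding positive_at_1_def by (metis inverse_divide)

lemma positive_at_1_divide: "positive_at_1 a \<Longrightarrow> positive_at_1 c \<Longrightarrow> positive_at_1 (a / c)"
  by (simp add: divide_inverse positive_at_1_mult positive_at_1_inverse)

lemma positive_at_1_lfr: "laurent_eval (\<lambda>_. 1::rat) P > 0 \<Longrightarrow> positive_at_1 (lfr P)"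
  unfolding positive_at_1_def by (intro exI[of _ P] exI[of _ 1]) auto

lemma positive_at_1_1 [simp]: "positive_at_1 1"
  using positive_at_1_lfr[of 1] by simp

lemma positive_at_1_lvar [simp]: "positive_at_1 (lfr (lvar i))"
  by (rule positive_at_1_lfr) simp

lemma positive_at_1_power: "positive_at_1 a \<Longrightarrow> positive_at_1 (a ^ m)"
  by (induction m) (auto intro: positive_at_1_mult)

lemma positive_at_1_prod: "(\<And>i. i \<in> A \<Longrightarrow> positive_at_1 (f i)) \<Longrightarrow> positive_at_1 (\<Prod>i\<in>A. f i)"
  by (induction A rule: infinite_finite_induct) (auto intro: positive_at_1_mult)

lemma positive_at_1_exchange_binomial:
    "(\<And>i. positive_at_1 (x i)) \<Longrightarrow> positive_at_1 (exchange_binomial N b k x)"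
  unfolding exchange_binomial_def by (intro positive_at_1_add positive_at_1_prod positive_at_1_power) auto

lemma positive_at_1_mutated_vars: "(\<And>i. positive_at_1 (x i)) \<Longrightarrow> positive_at_1 (mutated_vars N b k x i)"
  by (auto simp: mutated_vars_def intro: positive_at_1_divide positive_at_1_exchange_binomial)

lemma positive_at_1_vars_along: "(\<And>i. positive_at_1 (x i)) \<Longrightarrow> positive_at_1 (vars_along N b x ks i)"
  by (induction ks arbitrary: b x) (auto intro: positive_at_1_mutated_vars)

text \<open>The ring of the strong Laurent phenomenon: mutable variables may be inverted, while
  frozen ones, with index above \<open>n\<close>, occur polynomially.\<close>

definition partial_laurent :: "nat \<Rightarrow> laurent set" where
  "partial_laurent n = {G. \<forall>e\<in>Poly_Mapping.keys G. \<forall>i>n. Poly_Mapping.lookup e i \<ge> 0}"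

text \<open>Formulated for independent initial variables only; actual seeds are reached by
  specialization.\<close>

definition laurent_along :: "nat \<Rightarrow> nat \<Rightarrow> (nat \<Rightarrow> nat \<Rightarrow> int) \<Rightarrow> nat list \<Rightarrow> bool" where
  "laurent_along n N b ks \<longleftrightarrow>
     (\<forall>i\<in>{1..N}. vars_along N b (\<lambda>i. lfr (lvar i)) ks i \<in> lfr ` partial_laurent n)"

text \<open>Specialization commutes with mutation. Along each prefix the exchange relation is one
  between Laurent polynomials, so it survives evaluation at \<open>x\<close>, and it determines the
  new variable there because the old one is nonzero.\<close>

lemma laurent_along_transport:
  fixes x :: "nat \<Rightarrow> 'k::field"
  assumes "n \<le> N" "set ks \<subseteq> {1..n}" "\<And>i. x i \<noteq> 0"
    and "\<And>s. s < length ks \<Longrightarrow> laurent_along n N b (take s ks)"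
    and "\<And>s i. s < length ks \<Longrightarrow> i \<in> {1..N} \<Longrightarrow> vars_along N b x (take s ks) i \<noteq> 0"
    and "\<And>i. i \<in> {1..N} \<Longrightarrow> vars_along N b (\<lambda>i. lfr (lvar i)) ks i = lfr (G i)"
    and "i \<in> {1..N}"
  shows "vars_along N b x ks i = laurent_eval x (G i)"
  using assms(2,4-)
proof (induction ks arbitrary: G i rule: rev_induct)
  case Nil
  then have "G i = lvar i"
    by (metis vars_along.simps(1) to_fract_eq_iff)
  then show ?case by simp
next
  case (snoc k ks)
  let ?X = "\<lambda>i. lfr (lvar i)"
  have k: "k \<in> {1..N}"
    using snoc.prems assms(1) by auto
  have "laurent_along n N b ks"
    using snoc.prems(2)[of "length ks"] by simp
  then have "\<forall>i\<in>{1..N}. \<exists>g. vars_along N b ?X ks i = lfr g"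
    unfolding laurent_along_def by blast
  then obtain H where H: "\<And>i. i \<in> {1..N} \<Longrightarrow> vars_along N b ?X ks i = lfr (H i)"
    by metis
  have r: "vars_along N b x ks i = laurent_eval x (H i)" if "i \<in> {1..N}" for i
  proof (rule snoc.IH)
    show "laurent_along n N b (take s ks)" if "s < length ks" for s
      using snoc.prems(2)[of s] that by simp
    show "vars_along N b x (take s ks) i \<noteq> 0" if "s < length ks" "i \<in> {1..N}" for s i
      using snoc.prems(3)[of s] that by simp
  qed (use snoc.prems that H in auto)
  show ?case
  proof (cases "i = k")
    case False
    then have "lfr (G i) = lfr (H i)"
      using snoc.prems(4)[OF snoc.prems(5)] H[OF snoc.prems(5)] by (simp add: vars_along_snoc mutated_vars_def)
    then show ?thesis
      using False r[OF snoc.prems(5)] by (simp add: vars_along_snoc mutated_vars_def)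
  next
    case True
    let ?B = "matrix_along b ks"
    have nz: "vars_along N b x ks k \<noteq> 0"
      using snoc.prems(3)[of "length ks" k] k by simp
    have "lfr (G k) = exchange_binomial N ?B k (vars_along N b ?X ks) / vars_along N b ?X ks k"
      using snoc.prems(4)[OF k] by (simp add: vars_along_snoc mutated_vars_def)
    also have "exchange_binomial N ?B k (vars_along N b ?X ks) = lfr (exchange_binomial N ?B k H)"
      unfolding to_fract_exchange_binomial by (rule exchange_binomial_cong) (auto simp: H)
    finally have "lfr (G k) * lfr (H k) = lfr (exchange_binomial N ?B k H)"
      using H[OF k] positive_at_1_nonzero[OF positive_at_1_vars_along[of ?X N b ks k]] by (simp add: field_simps)
    \<comment> \<open>Cleared of its denominator, the exchange relation is an identity of Laurent
      polynomials, on which evaluation is multiplicative.\<close>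
    then have "G k * H k = exchange_binomial N ?B k H"
      by (simp flip: to_fract_mult)
    then have "laurent_eval x (G k) * laurent_eval x (H k) = exchange_binomial N ?B k (\<lambda>i. laurent_eval x (H i))"
      by (metis laurent_eval_mult laurent_eval_exchange_binomial assms(3))
    also have "\<dots> = exchange_binomial N ?B k (vars_along N b x ks)"
      by (rule exchange_binomial_cong) (auto simp: r)
    finally show ?thesis
      using nz r[OF k] True by (simp add: vars_along_snoc mutated_vars_def field_simps)
  qed
qed

section \<open>Subrings of a field and the clearing of denominators\<close>

locale subring_in_field =
  fixes S :: "'k::field set"
  assumes one_in: "1 \<in> S"
    and add_in: "a \<in> S \<Longrightarrow> c \<in> S \<Longrightarrow> a + c \<in> S"
    and mult_in: "a \<in> S \<Longrightarrow> c \<in> S \<Longrightarrow> a * c \<in> S"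
    and uminus_in: "a \<in> S \<Longrightarrow> - a \<in> S"
begin

lemma zero_in: "0 \<in> S"
  using add_in[OF one_in uminus_in[OF one_in]] by simp

lemma power_in: "a \<in> S \<Longrightarrow> a ^ m \<in> S"
  by (induction m) (auto intro: one_in mult_in)

lemma prod_in: "(\<And>i. i \<in> A \<Longrightarrow> f i \<in> S) \<Longrightarrow> prod f A \<in> S"
  by (induction A rule: infinite_finite_induct) (auto intro: one_in mult_in)

lemma sum_in: "(\<And>i. i \<in> A \<Longrightarrow> f i \<in> S) \<Longrightarrow> sum f A \<in> S"
  by (induction A rule: infinite_finite_induct) (auto intro: zero_in add_in)

lemma of_nat_in: "of_nat m \<in> S"
  by (induction m) (auto intro: zero_in one_in add_in)

lemma of_int_in: "of_int m \<in> S"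
  by (cases m rule: int_cases2) (auto intro: of_nat_in uminus_in)

lemma exchange_binomial_in: "(\<And>i. i \<in> {1..N} \<Longrightarrow> x i \<in> S) \<Longrightarrow> exchange_binomial N b k x \<in> S"
  unfolding exchange_binomial_def by (intro add_in prod_in power_in)

lemma clear_mono: "d \<in> S \<Longrightarrow> d ^ a * y \<in> S \<Longrightarrow> a \<le> a' \<Longrightarrow> d ^ a' * y \<in> S"
  by (metis (no_types, lifting) le_add_diff_inverse2 mult.assoc mult_in power_add power_in)

text \<open>A negative exponent \<open>- m\<close> occurs only at an index \<open>i \<le> n\<close>,
  and there \<open>d ^ m\<close> absorbs it, since \<open>d / x i\<close> is in
  \<open>S\<close>.\<close>

lemma clear_mon_eval:
  assumes x: "\<And>i. x i \<in> S" "\<And>i. x i \<noteq> 0" and d: "d \<in> S" "\<And>i. i \<le> n \<Longrightarrow> d / x i \<in> S"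
    and e: "\<And>i. i > n \<Longrightarrow> Poly_Mapping.lookup e i \<ge> 0"
  shows "\<exists>a. d ^ a * mon_eval x e \<in> S"
proof -
  have "\<exists>a. d ^ a * (\<Prod>i\<in>A. x i powi Poly_Mapping.lookup e i) \<in> S" if "finite A" for A
    using that
  proof (induction A rule: finite_induct)
    case empty
    then show ?case using one_in by (auto intro: exI[of _ 0])
  next
    case (insert i A)
    then obtain a where a: "d ^ a * (\<Prod>i\<in>A. x i powi Poly_Mapping.lookup e i) \<in> S"
      by blast
    have "\<exists>c. d ^ c * x i powi Poly_Mapping.lookup e i \<in> S"
    proof (cases "Poly_Mapping.lookup e i \<ge> 0")
      case True
      then show ?thesis
        using power_in[OF x(1)] by (intro exI[of _ 0]) (simp add: power_int_nonneg_exp)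
    next
      case False
      then obtain m where m: "Poly_Mapping.lookup e i = - int m"
        by (metis int_cases2 of_nat_0_le_iff)
      have "d / x i \<in> S"
        using False e[of i] d(2)[of i] by (cases "i \<le> n") auto
      then have "(d / x i) ^ m \<in> S"
        by (rule power_in)
      then show ?thesis
        by (intro exI[of _ m]) (simp add: m power_int_minus divide_inverse power_mult_distrib power_inverse)
    qed
    then obtain c where c: "d ^ c * x i powi Poly_Mapping.lookup e i \<in> S"
      by blast
    show ?case
      using mult_in[OF a c] insert.hyps by (intro exI[of _ "a + c"]) (simp add: power_add mult_ac)
  qed
  then show ?thesis
    unfolding mon_eval_def by simp
qed

lemma clear_laurent_eval:
  assumes x: "\<And>i. x i \<in> S" "\<And>i. x i \<noteq> 0" and d: "d \<in> S" "\<And>i. i \<le> n \<Longrightarrow> d / x i \<in> S"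
    and G: "G \<in> partial_laurent n"
  shows "\<exists>a. d ^ a * laurent_eval x G \<in> S"
proof -
  have "\<forall>e\<in>Poly_Mapping.keys G. \<exists>a. d ^ a * mon_eval x e \<in> S"
    using clear_mon_eval[of x d n] x d G unfolding partial_laurent_def by blast
  then obtain a where a: "\<And>e. e \<in> Poly_Mapping.keys G \<Longrightarrow> d ^ a e * mon_eval x e \<in> S"
    by metis
  \<comment> \<open>One exponent for all monomials. For \<open>G = 0\<close> the maximum is
    unspecified, but the sum is then empty.\<close>
  let ?m = "Max (a ` Poly_Mapping.keys G)"
  have "d ^ ?m * mon_eval x e \<in> S" if "e \<in> Poly_Mapping.keys G" for e
    by (rule clear_mono[OF d(1) a[OF that]]) (use that in auto)
  then have "(\<Sum>e\<in>Poly_Mapping.keys G. of_int (Poly_Mapping.lookup G e) * (d ^ ?m * mon_eval x e)) \<in> S"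
    by (intro sum_in mult_in[OF of_int_in])
  then show ?thesis
    unfolding laurent_eval_def sum_distrib_left by (intro exI[of _ ?m]) (simp add: mult_ac)
qed

section \<open>Congruence of Laurent expressions modulo an ideal\<close>

context
  fixes J :: "'k set" and x x' :: "nat \<Rightarrow> 'k"
  assumes J: "0 \<in> J" "\<And>a c. a \<in> J \<Longrightarrow> c \<in> J \<Longrightarrow> a + c \<in> J" "\<And>a s. a \<in> J \<Longrightarrow> s \<in> S \<Longrightarrow> s * a \<in> J"
    and x: "\<And>i. x i \<in> S" "\<And>i. inverse (x i) \<in> S" and nz: "\<And>i. x i \<noteq> 0"
    and x': "\<And>i. x' i \<in> S" "\<And>i. inverse (x' i) \<in> S" and nz': "\<And>i. x' i \<noteq> 0"
    and xx': "\<And>i. x i - x' i \<in> J"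
begin

definition cong_ideal :: "'k \<Rightarrow> 'k \<Rightarrow> bool" where
  "cong_ideal u v \<longleftrightarrow> u \<in> S \<and> v \<in> S \<and> u - v \<in> J"

lemma cong_ideal_mult: "cong_ideal u v \<Longrightarrow> cong_ideal u' v' \<Longrightarrow> cong_ideal (u * u') (v * v')"
proof -
  assume *: "cong_ideal u v" "cong_ideal u' v'"
  have "u * u' - v * v' = u' * (u - v) + v * (u' - v')"
    by (simp add: algebra_simps)
  also have "\<dots> \<in> J"
    using * unfolding cong_ideal_def by (intro J(2,3)) auto
  finally show ?thesis
    using * by (auto simp: cong_ideal_def mult_in)
qed

lemma cong_ideal_add: "cong_ideal u v \<Longrightarrow> cong_ideal u' v' \<Longrightarrow> cong_ideal (u + u') (v + v')"
  using J(2)[of "u - v" "u' - v'"] by (auto simp: cong_ideal_def add_in algebra_simps)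

lemma cong_ideal_refl: "u \<in> S \<Longrightarrow> cong_ideal u u"
  by (simp add: cong_ideal_def J(1))

lemma cong_ideal_power: "cong_ideal u v \<Longrightarrow> cong_ideal (u ^ m) (v ^ m)"
  by (induction m) (auto intro: cong_ideal_mult cong_ideal_refl one_in)

lemma cong_ideal_powi: "cong_ideal (x i powi a) (x' i powi a)"
proof -
  have c: "cong_ideal (x i) (x' i)"
    by (simp add: cong_ideal_def x x' xx')
  have "inverse (x i) - inverse (x' i) = (- inverse (x i) * inverse (x' i)) * (x i - x' i)"
    using nz nz' by (simp add: field_simps)
  also have "\<dots> \<in> J"
    by (intro J(3) xx' mult_in uminus_in x x')
  finally have c': "cong_ideal (inverse (x i)) (inverse (x' i))"
    by (simp add: cong_ideal_def x x')
  show ?thesis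
    using cong_ideal_power[OF c] cong_ideal_power[OF c']
    by (cases a rule: int_cases2) (auto simp: power_int_minus simp flip: power_inverse)
qed

lemma cong_ideal_prod: "(\<And>i. i \<in> A \<Longrightarrow> cong_ideal (f i) (g i)) \<Longrightarrow> cong_ideal (prod f A) (prod g A)"
  by (induction A rule: infinite_finite_induct) (auto intro: cong_ideal_mult cong_ideal_refl one_in)

lemma cong_ideal_sum: "(\<And>i. i \<in> A \<Longrightarrow> cong_ideal (f i) (g i)) \<Longrightarrow> cong_ideal (sum f A) (sum g A)"
  by (induction A rule: infinite_finite_induct) (auto intro: cong_ideal_add cong_ideal_refl zero_in)

text \<open>Congruence passes through sums and products, and also through negative powers: the
  coordinates are units of \<open>S\<close>, and inverses of congruent units are congruent.\<close>

lemma laurent_eval_diff_in_ideal: "laurent_eval x G - laurent_eval x' G \<in> J"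
proof -
  have "cong_ideal (laurent_eval x G) (laurent_eval x' G)"
    unfolding laurent_eval_def mon_eval_def
    by (intro cong_ideal_sum cong_ideal_mult cong_ideal_refl of_int_in cong_ideal_prod cong_ideal_powi)
  then show ?thesis
    by (simp add: cong_ideal_def)
qed

end

end

section \<open>Laurent polynomials with polynomial dependence on the frozen variables\<close>

lemma subring_range_lfr: "subring_in_field (range lfr)"
proof
  show "1 \<in> range lfr" by (metis rangeI to_fract_1)
  show "a + c \<in> range lfr" if "a \<in> range lfr" "c \<in> range lfr" for a c
    using that by (auto simp flip: to_fract_add)
  show "a * c \<in> range lfr" if "a \<in> range lfr" "c \<in> range lfr" for a c
    using that by (auto simp flip: to_fract_mult)
  show "- a \<in> range lfr" if "a \<in> range lfr" for a
    using that by (auto simp flip: to_fract_uminus)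
qed

lemma partial_laurent_1: "1 \<in> partial_laurent n"
  by (simp add: partial_laurent_def)

lemma partial_laurent_add: "a \<in> partial_laurent n \<Longrightarrow> c \<in> partial_laurent n \<Longrightarrow> a + c \<in> partial_laurent n"
  using keys_add[of a c] unfolding partial_laurent_def by blast

lemma partial_laurent_mult: "a \<in> partial_laurent n \<Longrightarrow> c \<in> partial_laurent n \<Longrightarrow> a * c \<in> partial_laurent n"
  using keys_mult[of a c] unfolding partial_laurent_def by (fastforce simp: lookup_add)

lemma partial_laurent_lvar: "lvar i \<in> partial_laurent n"
  by (auto simp: partial_laurent_def lvar_def lookup_single when_def)

lemma partial_laurent_linv: "i \<le> n \<Longrightarrow> linv i \<in> partial_laurent n"
  by (auto simp: partial_laurent_def linv_def lookup_single when_def)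

lemma subring_partial_laurent: "subring_in_field (lfr ` partial_laurent n)"
proof
  show "1 \<in> lfr ` partial_laurent n"
    using partial_laurent_1 by force
  show "a + c \<in> lfr ` partial_laurent n" if "a \<in> lfr ` partial_laurent n" "c \<in> lfr ` partial_laurent n" for a c
    using that partial_laurent_add by (force simp flip: to_fract_add)
  show "a * c \<in> lfr ` partial_laurent n" if "a \<in> lfr ` partial_laurent n" "c \<in> lfr ` partial_laurent n" for a c
    using that partial_laurent_mult by (force simp flip: to_fract_mult)
  show "- a \<in> lfr ` partial_laurent n" if "a \<in> lfr ` partial_laurent n" for a
    using that by (force simp: partial_laurent_def simp flip: to_fract_uminus)
qed

section \<open>Cancelling exchange binomials without creating frozen denominators\<close>

lemma lookup_single_mult:
  fixes y :: laurent
  shows "Poly_Mapping.lookup (Poly_Mapping.single \<alpha> 1 * y) v = Poly_Mapping.lookup y (v - \<alpha>)"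
proof -
  have "(v = \<alpha> + q) = (q = v - \<alpha>)" for q
    by (auto simp: algebra_simps)
  moreover have "Poly_Mapping.lookup (Poly_Mapping.single \<alpha> 1) a * t = (t when a = \<alpha>)" for a and t :: int
    by (simp add: lookup_single when_def)
  ultimately show ?thesis
    by (simp add: lookup_mult)
qed

text \<open>No variable above \<open>n\<close> divides the binomial. If \<open>y\<close> had a
  negative exponent in such a variable \<open>w\<close>, take its terms of least exponent
  \<open>m\<close> in \<open>w\<close>, and among these one of greatest exponent in
  \<open>z\<close>. One of its two shifts cannot be cancelled and still has exponent
  \<open>m\<close> in \<open>w\<close>.\<close>

lemma partial_laurent_cancel:
  fixes y :: laurent and \<alpha> \<beta> :: "nat \<Rightarrow>\<^sub>0 int"
  assumes f: "(Poly_Mapping.single \<alpha> 1 + Poly_Mapping.single \<beta> 1) * y \<in> partial_laurent n"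
    and nonneg: "\<And>w. w > n \<Longrightarrow> Poly_Mapping.lookup \<alpha> w \<ge> 0" "\<And>w. w > n \<Longrightarrow> Poly_Mapping.lookup \<beta> w \<ge> 0"
    and disj: "\<And>w. w > n \<Longrightarrow> Poly_Mapping.lookup \<alpha> w = 0 \<or> Poly_Mapping.lookup \<beta> w = 0"
    and z: "Poly_Mapping.lookup \<alpha> z > Poly_Mapping.lookup \<beta> z"
  shows "y \<in> partial_laurent n"
proof (rule ccontr)
  assume "y \<notin> partial_laurent n"
  then obtain w e0 where w: "w > n" "e0 \<in> Poly_Mapping.keys y" "Poly_Mapping.lookup e0 w < 0"
    unfolding partial_laurent_def by force
  define m where "m = Min ((\<lambda>e. Poly_Mapping.lookup e w) ` Poly_Mapping.keys y)"
  have m_le: "m \<le> Poly_Mapping.lookup e w" if "e \<in> Poly_Mapping.keys y" for e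
    unfolding m_def using that by simp
  have m_neg: "m < 0"
    using m_le[OF w(2)] w(3) by simp
  define K where "K = {e \<in> Poly_Mapping.keys y. Poly_Mapping.lookup e w = m}"
  have "m \<in> (\<lambda>e. Poly_Mapping.lookup e w) ` Poly_Mapping.keys y"
    unfolding m_def by (rule Min_in) (use w(2) in auto)
  then have K: "K \<noteq> {}" "finite K"
    by (auto simp: K_def)
  \<comment> \<open>The exponent in \<open>z\<close> decides when \<open>w\<close> occurs in neither
    monomial, because then both shifts stay at level \<open>m\<close>.\<close>
  define M where "M = Max ((\<lambda>e. Poly_Mapping.lookup e z) ` K)"
  have "M \<in> (\<lambda>e. Poly_Mapping.lookup e z) ` K"
    unfolding M_def by (rule Max_in) (use K in auto)
  then obtain e where e: "e \<in> K" "Poly_Mapping.lookup e z = M"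
    by auto
  have M_ge: "Poly_Mapping.lookup e' z \<le> M" if "e' \<in> K" for e'
    unfolding M_def using that K by simp
  have vanish: "Poly_Mapping.lookup y e' = 0"
    if "Poly_Mapping.lookup e' w < m \<or> Poly_Mapping.lookup e' w = m \<and> Poly_Mapping.lookup e' z > M" for e'
    using that m_le[of e'] M_ge[of e'] by (force simp: K_def in_keys_iff)
  have ye: "Poly_Mapping.lookup y e \<noteq> 0" and ew: "Poly_Mapping.lookup e w = m"
    using e(1) by (auto simp: K_def in_keys_iff)
  have coeff: "Poly_Mapping.lookup ((Poly_Mapping.single \<alpha> 1 + Poly_Mapping.single \<beta> 1) * y) v =
      Poly_Mapping.lookup y (v - \<alpha>) + Poly_Mapping.lookup y (v - \<beta>)" for v
    by (simp add: distrib_right lookup_add lookup_single_mult)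
  have key: "Poly_Mapping.lookup v w \<ge> 0"
    if "Poly_Mapping.lookup y (v - \<alpha>) + Poly_Mapping.lookup y (v - \<beta>) \<noteq> 0" for v
    using f that w(1) unfolding partial_laurent_def by (auto simp: in_keys_iff coeff)
  show False
  proof (cases "Poly_Mapping.lookup \<alpha> w = 0")
    case True
    have "Poly_Mapping.lookup y (e + \<alpha> - \<beta>) = 0"
      by (rule vanish) (use True ew e(2) z nonneg(2)[OF w(1)] in \<open>auto simp: lookup_add lookup_minus\<close>)
    then have "Poly_Mapping.lookup (e + \<alpha>) w \<ge> 0"
      by (intro key) (simp add: ye)
    then show False
      using True ew m_neg by (simp add: lookup_add)
  next
    case False
    then have \<beta>: "Poly_Mapping.lookup \<beta> w = 0"
      using disj[OF w(1)] by simp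
    have "Poly_Mapping.lookup y (e + \<beta> - \<alpha>) = 0"
      by (rule vanish) (use False \<beta> ew nonneg(1)[OF w(1)] in \<open>auto simp: lookup_add lookup_minus\<close>)
    then have "Poly_Mapping.lookup (e + \<beta>) w \<ge> 0"
      by (intro key) (simp add: ye)
    then show False
      using \<beta> ew m_neg by (simp add: lookup_add)
  qed
qed

lemma prod_lvar_power:
  assumes "finite A"
  shows "(\<Prod>i\<in>A. lvar i ^ f i) = Poly_Mapping.single (\<Sum>i\<in>A. Poly_Mapping.single i (int (f i))) 1"
proof -
  have "lvar i ^ m = Poly_Mapping.single (Poly_Mapping.single i (int m)) 1" for i m
    by (induction m) (auto simp: lvar_def mult_single simp flip: single_add)
  moreover have "(\<Prod>i\<in>A. Poly_Mapping.single (g i) (1::int)) = Poly_Mapping.single (\<Sum>i\<in>A. g i) 1"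
    for g :: "nat \<Rightarrow> (nat \<Rightarrow>\<^sub>0 int)"
    using assms by (induction A rule: finite_induct) (auto simp: mult_single)
  ultimately show ?thesis by simp
qed

text \<open>The two monomials have disjoint supports, as an entry of column \<open>j\<close> is not
  both positive and negative, and \<open>b z j > 0\<close> makes them differ at
  \<open>z\<close>.\<close>

lemma exchange_binomial_lvar_cancel:
  assumes "exchange_binomial N b j lvar * y \<in> partial_laurent n" "z \<in> {1..N}" "b z j > 0"
  shows "y \<in> partial_laurent n"
proof -
  let ?e = "\<lambda>f. \<Sum>i\<in>{1..N}. Poly_Mapping.single i (int (f i))"
  have l: "Poly_Mapping.lookup (?e f) w = (if w \<in> {1..N} then int (f w) else 0)" for f w
    by (simp add: lookup_sum lookup_single when_def)
  have "exchange_binomial N b j lvar =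
      Poly_Mapping.single (?e (\<lambda>i. nat (b i j))) 1 + Poly_Mapping.single (?e (\<lambda>i. nat (- b i j))) 1"
    by (simp only: exchange_binomial_def prod_lvar_power finite_atLeastAtMost)
  then show ?thesis
    using assms partial_laurent_cancel[of "?e (\<lambda>i. nat (b i j))" "?e (\<lambda>i. nat (- b i j))" y n z]
    unfolding l by auto
qed

text \<open>Replacing \<open>z\<close> by \<open>w\<close> changes \<open>h\<close> by a multiple of
  \<open>lvar z - w\<close>, hence of \<open>p\<close>. As \<open>h\<close> may contain negative
  powers of \<open>z\<close>, \<open>w\<close> has to be a unit.\<close>

lemma laurent_eval_kernel:
  fixes p w w' c h :: laurent
  assumes "w * w' = 1" "lvar z - w = p * c"
    and "laurent_eval ((\<lambda>i. lfr (lvar i))(z := lfr w)) h = 0"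
  shows "p dvd h"
proof -
  let ?X = "\<lambda>i. lfr (lvar i)" and ?J = "range (\<lambda>g. lfr (p * g))"
  interpret subring_in_field "range lfr"
    by (rule subring_range_lfr)
  have winv: "inverse (lfr w) = lfr w'"
    by (metis assms(1) inverse_unique to_fract_1 to_fract_mult)
  have w0: "w \<noteq> 0"
    using assms(1) by auto
  have "laurent_eval ?X h - laurent_eval (?X(z := lfr w)) h \<in> ?J"
  proof (rule laurent_eval_diff_in_ideal)
    show "0 \<in> ?J"
      by (metis mult_zero_right rangeI to_fract_0)
    show "a + d \<in> ?J" if "a \<in> ?J" "d \<in> ?J" for a d
    proof -
      obtain g g' where "a = lfr (p * g)" "d = lfr (p * g')"
        using \<open>a \<in> ?J\<close> \<open>d \<in> ?J\<close> by blast
      then have "a + d = lfr (p * (g + g'))"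
        by (simp add: distrib_left)
      then show ?thesis by blast
    qed
    show "s * a \<in> ?J" if "a \<in> ?J" "s \<in> range lfr" for a s
    proof -
      obtain g g' where "a = lfr (p * g)" "s = lfr g'"
        using \<open>a \<in> ?J\<close> \<open>s \<in> range lfr\<close> by blast
      then have "s * a = lfr (p * (g' * g))"
        by (simp add: mult_ac)
      then show ?thesis by blast
    qed
    show "?X i - (?X(z := lfr w)) i \<in> ?J" for i
    proof (cases "i = z")
      case True
      then have "?X i - (?X(z := lfr w)) i = lfr (p * c)"
        using assms(2) by (simp flip: to_fract_diff)
      then show ?thesis by blast
    next
      case False
      then have "?X i - (?X(z := lfr w)) i = lfr (p * 0)" by simp
      then show ?thesis by blast
    qed
    show "inverse (?X i) \<in> range lfr" for i
      by (metis lfr_linv rangeI)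
    show "inverse ((?X(z := lfr w)) i) \<in> range lfr" for i
      by (cases "i = z") (auto simp: winv simp flip: lfr_linv)
  qed (use w0 in auto)
  then obtain g where "lfr h = lfr (p * g)"
    by (auto simp: assms(3) laurent_eval_lfr)
  then show ?thesis
    by (simp only: to_fract_eq_iff dvd_triv_left)
qed

text \<open>Evaluation at \<open>x\<close> maps to a field and has kernel generated by
  \<open>p\<close>, so \<open>p\<close> is prime and does not divide \<open>g\<close>. Comparing the
  two expressions for multiples of \<open>y\<close>, one factor \<open>p\<close> at a time can be
  cancelled.\<close>

lemma laurent_descent:
  fixes p g :: laurent
  assumes "\<And>i. x i \<noteq> 0" "\<And>h. laurent_eval x h = 0 \<Longrightarrow> p dvd h" "laurent_eval x p = 0" "p \<noteq> 0"
    and "laurent_eval x g \<noteq> 0" "lfr g ^ c * y \<in> range lfr" "lfr p ^ a * y \<in> range lfr"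
  shows "y \<in> range lfr"
  using assms(7)
proof (induction a)
  case (Suc a)
  then obtain A where A: "lfr p ^ Suc a * y = lfr A" by blast
  obtain C where C: "lfr g ^ c * y = lfr C" using assms(6) by blast
  have "lfr (A * g ^ c) = lfr (p ^ Suc a * C)"
    by (simp only: to_fract_mult to_fract_power flip: A C) (simp add: mult_ac)
  then have "A * g ^ c = p ^ Suc a * C"
    by (simp only: to_fract_eq_iff)
  then have "laurent_eval x A * laurent_eval x g ^ c = 0"
    by (metis assms(1,3) laurent_eval_mult laurent_eval_power mult_zero_left power_Suc)
  then have "p dvd A"
    using assms(2,5) by simp
  then obtain A' where "A = p * A'" by blast
  then have "lfr p * (lfr p ^ a * y) = lfr p * lfr A'"
    using A by (simp add: mult_ac)
  then have "lfr p ^ a * y = lfr A'"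
    using assms(4) by simp
  then show ?case
    by (intro Suc.IH) simp
qed auto

section \<open>Three consecutive mutations in directions \<open>j\<close>, \<open>k\<close>,
  \<open>j\<close>\<close>

lemma exchange_binomial_split:
  fixes x :: "nat \<Rightarrow> 'a::comm_ring_1"
  assumes "j \<noteq> k" "j \<in> {1..N}" "k \<in> {1..N}" "b k k = 0"
  shows "exchange_binomial N b k x =
     x j ^ nat (b j k) * (\<Prod>i\<in>{1..N} - {j, k}. x i ^ nat (b i k)) +
     x j ^ nat (- b j k) * (\<Prod>i\<in>{1..N} - {j, k}. x i ^ nat (- b i k))"
proof -
  have "(\<Prod>i\<in>{1..N}. x i ^ f i) = x j ^ f j * (\<Prod>i\<in>{1..N} - {j, k}. x i ^ f i)"
    if "f k = 0" for f :: "nat \<Rightarrow> nat"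
  proof -
    have "(\<Prod>i\<in>{1..N}. x i ^ f i) = x j ^ f j * (\<Prod>i\<in>{1..N} - {j}. x i ^ f i)"
      using assms by (intro prod.remove) auto
    also have "(\<Prod>i\<in>{1..N} - {j}. x i ^ f i) = x k ^ f k * (\<Prod>i\<in>{1..N} - {j} - {k}. x i ^ f i)"
      using assms by (intro prod.remove) auto
    also have "{1..N} - {j} - {k} = {1..N} - {j, k}" by auto
    finally show ?thesis using that by simp
  qed
  then show ?thesis
    using assms(4) by (simp add: exchange_binomial_def)
qed

lemma lvar_prod_inverse: "\<exists>g. (\<Prod>i\<in>A. lvar i ^ f i) * g = 1"
proof -
  have "(\<Prod>i\<in>A. lvar i ^ f i) * (\<Prod>i\<in>A. linv i ^ f i) = 1"
    by (simp flip: prod.distrib power_mult_distrib)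
  then show ?thesis by blast
qed

text \<open>The third new variable \<open>r\<close> is again Laurent because its exchange binomial
  is a multiple of \<open>p\<close>. The second claim prepares the proof that \<open>p\<close> does
  not divide \<open>r\<close>: where \<open>p\<close> and \<open>r\<close> vanish and
  \<open>q\<close> does not, the coordinate at \<open>j\<close> is determined by the others.\<close>

lemma exchange_binomial_three_steps:
  fixes p q :: laurent
  assumes jk: "j \<noteq> k" "j \<in> {1..n}" "k \<in> {1..n}" and nN: "n \<le> N"
    and skew: "skew_symmetrizable n b" and bkj: "b k j \<ge> 0"
  defines "b1 \<equiv> mutated_entry b j"
  defines "b2 \<equiv> mutated_entry b1 k"
  assumes p: "lvar j * p = exchange_binomial N b j lvar"
    and q: "lvar k * q = exchange_binomial N b1 k (lvar(j := p))"
  shows "\<exists>r. p * r = exchange_binomial N b2 j (lvar(j := p, k := q)) \<and>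
    (\<forall>x x' :: nat \<Rightarrow> laurent fract. (\<forall>i. x i \<noteq> 0) \<longrightarrow> (\<forall>i. x' i \<noteq> 0) \<longrightarrow> (\<forall>i. i \<noteq> j \<longrightarrow> x i = x' i) \<longrightarrow>
       laurent_eval x p = 0 \<longrightarrow> laurent_eval x' p = 0 \<longrightarrow> exchange_binomial N b1 k (x(j := 0)) \<noteq> 0 \<longrightarrow>
       laurent_eval x r = 0 \<longrightarrow> laurent_eval x' r = 0 \<longrightarrow> x j = x' j)"
proof -
  let ?A = "{1..N} - {j, k}"
  let ?P = "\<lambda>f. \<Prod>i\<in>?A. lvar i ^ f i"
  have jkN: "j \<in> {1..N}" "k \<in> {1..N}"
    using jk nN by auto
  have skew1: "skew_symmetrizable n b1" and skew2: "skew_symmetrizable n b2"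
    unfolding b1_def b2_def by (intro skew_symmetrizable_mutated_entry skew jk)+
  \<comment> \<open>\<open>c\<close> and \<open>e\<close> are the exponents linking \<open>j\<close>
    and \<open>k\<close>. On the remaining rows \<open>a\<close>, \<open>f\<close>, \<open>d\<close>
    are the positive parts of the columns used for \<open>p\<close>, \<open>q\<close>,
    \<open>r\<close>, and the primed versions are the negative parts.\<close>
  define c where "c = nat (b k j)"
  define e where "e = nat (b1 j k)"
  define a a' where "a = (\<lambda>i. nat (b i j))" and "a' = (\<lambda>i. nat (- b i j))"
  define f f' where "f = (\<lambda>i. nat (b1 i k))" and "f' = (\<lambda>i. nat (- b1 i k))"
  define d d' where "d = (\<lambda>i. nat (b2 i j))" and "d' = (\<lambda>i. nat (- b2 i j))"
  have "sgn (b j k) = - sgn (b k j)"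
    by (rule skew_symmetrizable_sgn[OF skew]) (use jk in auto)
  then have bjk: "b j k \<le> 0" and bjk0: "b j k = 0 \<longleftrightarrow> b k j = 0"
    using bkj by (auto simp: sgn_if split: if_splits)
  have b1jk: "b1 j k = - b j k" and b1kj: "b1 k j = - b k j"
    by (auto simp: b1_def mutated_entry_def)
  then have b2kj: "b2 k j = b k j"
    by (simp add: b2_def mutated_entry_def)
  have e0: "e = 0 \<longleftrightarrow> c = 0"
    using bjk bjk0 bkj by (auto simp: e_def c_def b1jk)
  have p': "lvar j * p = lvar k ^ c * ?P a + ?P a'"
    using p exchange_binomial_split[of k j N b lvar] jk jkN skew_symmetrizable_diag[OF skew, of j] bkj
    by (simp add: c_def a_def a'_def insert_commute)
  have q_eval: "exchange_binomial N b1 k x = x j ^ e * (\<Prod>i\<in>?A. x i ^ f i) + (\<Prod>i\<in>?A. x i ^ f' i)"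
    for x :: "nat \<Rightarrow> 'z::comm_ring_1"
    using exchange_binomial_split[of j k N b1 x] jk jkN skew_symmetrizable_diag[OF skew1, of k] bjk
    by (simp add: e_def f_def f'_def b1jk)
  have q': "lvar k * q = p ^ e * ?P f + ?P f'"
    unfolding q q_eval by simp
  have r': "exchange_binomial N b2 j (lvar(j := p, k := q)) = q ^ c * ?P d + ?P d'"
    using exchange_binomial_split[of k j N b2 "lvar(j := p, k := q)"]
        jk jkN skew_symmetrizable_diag[OF skew2, of j] bkj
    by (simp add: c_def d_def d'_def b2kj insert_commute)
  \<comment> \<open>This is the mutation rule \<open>b2 i j = - b i j - c * f' i\<close>, rewritten
    without negative terms so that it becomes an equality of monomials.\<close>
  have exps: "d i + a i + c * f' i = d' i + a' i" if "i \<in> ?A" for i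
  proof -
    have "b2 i j = - b i j + sgn (b1 i k) * max (b1 i k * (- b k j)) 0"
      using that jk(1) by (simp add: b2_def mutated_entry_def b1kj) (simp add: b1_def mutated_entry_def)
    moreover have "sgn (b1 i k) * max (b1 i k * (- b k j)) 0 = - (b k j * max (- b1 i k) 0)"
      using bkj by (auto simp: sgn_if max_def mult_le_0_iff zero_le_mult_iff mult.commute)
    moreover have "int (nat t) = max t 0" for t :: int by simp
    ultimately have "int (d i + a i + c * f' i) = int (d' i + a' i)"
      using bkj unfolding d_def d'_def a_def a'_def c_def f'_def of_nat_add of_nat_mult
      by (simp add: max_def split: if_splits)
    then show ?thesis by (simp only: of_nat_eq_iff)
  qed
  have D: "?P d * ?P a * ?P f' ^ c = ?P d' * ?P a'"
  proof -
    have "?P d * ?P a * ?P f' ^ c = ?P (\<lambda>i. d i + a i + c * f' i)"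
      by (simp add: power_add prod.distrib power_mult mult.commute[of c] flip: prod_power_distrib)
    also have "\<dots> = ?P (\<lambda>i. d' i + a' i)"
      by (rule prod.cong) (auto simp only: exps)
    finally show ?thesis
      by (simp add: power_add prod.distrib)
  qed
  \<comment> \<open>The cofactor in the factorization of a difference of \<open>c\<close>-th powers;
    \<open>lvar k * q\<close> and \<open>?P f'\<close> differ by a multiple of
    \<open>p ^ e\<close>.\<close>
  define T where "T = (\<Sum>i<c. ?P f' ^ (c - Suc i) * (lvar k * q) ^ i)"
  have T: "(lvar k * q) ^ c - ?P f' ^ c = p ^ e * ?P f * T"
    unfolding T_def power_diff_sumr2 using q' by simp
  \<comment> \<open>For \<open>e = 0\<close> truncated subtraction gives
    \<open>p ^ (e - 1) = 1\<close>, and \<open>T\<close> is an empty sum because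
    \<open>c = 0\<close> as well.\<close>
  have pT: "p * (p ^ (e - 1) * T) = p ^ e * T"
  proof (cases "e = 0")
    case True
    then show ?thesis using e0 by (simp add: T_def)
  next
    case False
    then show ?thesis by (simp add: power_eq_if)
  qed
  \<comment> \<open>Up to a unit monomial this is \<open>r\<close>. Its form is found by inserting
    the relations for \<open>lvar j * p\<close> and \<open>(lvar k * q) ^ c\<close> into the
    binomial and taking out \<open>p\<close>.\<close>
  define R where "R = ?P d' * (q ^ c * lvar j - ?P a * ?P f * (p ^ (e - 1) * T))"
  have "p * R = ?P d' * (q ^ c * (lvar j * p) - ?P a * ?P f * (p * (p ^ (e - 1) * T)))"
    by (simp add: R_def algebra_simps)
  also have "\<dots> = ?P d' * (q ^ c * (lvar k ^ c * ?P a + ?P a') - ?P a * ((lvar k * q) ^ c - ?P f' ^ c))"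
    unfolding p' pT T by (simp add: mult_ac)
  also have "\<dots> = ?P d' * ?P a' * q ^ c + ?P d' * ?P a * ?P f' ^ c"
    by (simp add: algebra_simps)
  also have "\<dots> = ?P a * ?P f' ^ c * (q ^ c * ?P d + ?P d')"
    unfolding D[symmetric] by (simp add: algebra_simps)
  finally have pR: "p * R = ?P a * ?P f' ^ c * (q ^ c * ?P d + ?P d')" .
  obtain g1 g2 where g: "?P a * g1 = 1" "?P f' * g2 = 1"
    using lvar_prod_inverse by blast
  then have u: "?P a * ?P f' ^ c * (g1 * g2 ^ c) = 1"
    by (metis (no_types, lifting) mult.assoc mult.left_commute mult_1_right power_mult_distrib power_one)
  define r where "r = g1 * g2 ^ c * R"
  have "p * r = g1 * g2 ^ c * (p * R)"
    by (simp add: r_def mult_ac)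
  also have "\<dots> = (?P a * ?P f' ^ c * (g1 * g2 ^ c)) * (q ^ c * ?P d + ?P d')"
    unfolding pR by (simp only: mult_ac)
  finally have pr: "p * r = exchange_binomial N b2 j (lvar(j := p, k := q))"
    unfolding u r' by simp
  have "?P a * ?P f' ^ c * r = (?P a * ?P f' ^ c * (g1 * g2 ^ c)) * R"
    unfolding r_def by (simp only: mult.assoc)
  then have rR: "?P a * ?P f' ^ c * r = R"
    unfolding u by simp
  \<comment> \<open>The right-hand side is free of \<open>x j\<close>: where \<open>p\<close>
    vanishes, \<open>q\<close> takes the value \<open>Q\<close>, computed with 0 in place of
    \<open>x j\<close>. The factor \<open>0 ^ (e - 1)\<close> is the value of
    \<open>p ^ (e - 1)\<close>.\<close>
  have key: "x j * laurent_eval x q ^ c =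
      M a * M f * (0 ^ (e - 1) * (\<Sum>i<c. M f' ^ (c - Suc i) * (x k * Q) ^ i))
      \<and> laurent_eval x q = Q"
    if x: "\<And>i. x i \<noteq> 0" and px: "laurent_eval x p = 0" and rx: "laurent_eval x r = 0"
      and M: "M = (\<lambda>f. \<Prod>i\<in>?A. x i ^ f i)" and Q: "Q = exchange_binomial N b1 k (x(j := 0)) / x k"
    for x :: "nat \<Rightarrow> laurent fract" and M Q
  proof -
    have eP: "laurent_eval x (?P h) = M h" for h
      by (simp add: M laurent_eval_prod laurent_eval_power x)
    have "x k * laurent_eval x q = laurent_eval x (lvar k * q)"
      by (simp add: laurent_eval_mult x)
    also have "\<dots> = exchange_binomial N b1 k (x(j := 0))"
      unfolding q laurent_eval_exchange_binomial[OF x] by (rule exchange_binomial_cong) (auto simp: px)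
    finally have qx: "laurent_eval x q = Q"
      using x[of k] by (simp add: Q field_simps)
    have "laurent_eval x R = 0"
      unfolding rR[symmetric] by (simp add: laurent_eval_mult x rx)
    then have "M d' * (Q ^ c * x j -
        M a * M f * (0 ^ (e - 1) * (\<Sum>i<c. M f' ^ (c - Suc i) * (x k * Q) ^ i))) = 0"
      unfolding R_def T_def
      by (simp only: laurent_eval_mult[OF x] laurent_eval_diff laurent_eval_power[OF x] eP
          laurent_eval_lvar laurent_eval_sum qx px)
    moreover have "M d' \<noteq> 0"
      by (simp add: M x)
    ultimately show ?thesis
      by (simp add: qx mult.commute)
  qed
  show ?thesis
  proof (intro exI conjI allI impI)
    show "p * r = exchange_binomial N b2 j (lvar(j := p, k := q))"
      by (rule pr)
  next
    fix x x' :: "nat \<Rightarrow> laurent fract"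
    assume x: "\<forall>i. x i \<noteq> 0" and x': "\<forall>i. x' i \<noteq> 0" and xx': "\<forall>i. i \<noteq> j \<longrightarrow> x i = x' i"
      and px: "laurent_eval x p = 0" "laurent_eval x' p = 0" and nz: "exchange_binomial N b1 k (x(j := 0)) \<noteq> 0"
      and rx: "laurent_eval x r = 0" "laurent_eval x' r = 0"
    define M where "M = (\<lambda>f. \<Prod>i\<in>?A. x i ^ f i)"
    define Q where "Q = exchange_binomial N b1 k (x(j := 0)) / x k"
    have M': "M = (\<lambda>f. \<Prod>i\<in>?A. x' i ^ f i)"
      unfolding M_def by (intro ext prod.cong) (use xx' in auto)
    have xx'': "x(j := 0) = x'(j := 0)"
      using xx' by auto
    have Q': "Q = exchange_binomial N b1 k (x'(j := 0)) / x' k"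
      using xx' jk unfolding Q_def xx'' by simp
    have "x k = x' k"
      using xx' jk by simp
    moreover note key[OF _ px(1) rx(1) M_def Q_def] key[OF _ px(2) rx(2) M' Q']
    ultimately have "x j * Q ^ c = x' j * Q ^ c"
      using x x' by metis
    then show "x j = x' j"
      using nz x by (simp add: Q_def)
  qed
qed

section \<open>The Laurent phenomenon\<close>

lemma laurent_along_generic_step:
  assumes jk: "j \<noteq> k" "j \<in> {1..n}" "k \<in> {1..n}" and ks: "set ks \<subseteq> {1..n}"
    and skew: "skew_symmetrizable n b" and bkj: "b k j \<ge> 0"
    and z: "z \<in> {1..N}" "z > n" "b z j = 1" "b z k = 0"
    and IH: "\<And>b' ks'. skew_symmetrizable n b' \<Longrightarrow> set ks' \<subseteq> {1..n} \<Longrightarrow>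
      length ks' < length (j # k # ks) \<Longrightarrow> laurent_along n N b' ks'"
  shows "laurent_along n N b (j # k # ks)"
proof -
  let ?X = "\<lambda>i. lfr (lvar i)"
  define b1 b2 b3 where "b1 = mutated_entry b j" and "b2 = mutated_entry b1 k" and "b3 = mutated_entry b2 j"
  have nN: "n \<le> N" using z by auto
  have jkN: "j \<in> {1..N}" "k \<in> {1..N}" using jk nN by auto
  have skew': "skew_symmetrizable n b1" "skew_symmetrizable n b2" "skew_symmetrizable n b3"
    unfolding b1_def b2_def b3_def by (intro skew_symmetrizable_mutated_entry skew jk)+
  have diag: "b j j = 0" "b1 k k = 0" "b2 j j = 0" "b3 j j = 0"
    using skew skew' jk by (auto intro: skew_symmetrizable_diag)
  define p where "p = linv j * exchange_binomial N b j lvar"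
  define q where "q = linv k * exchange_binomial N b1 k (lvar(j := p))"
  have p: "lvar j * p = exchange_binomial N b j lvar"
    by (simp add: p_def flip: mult.assoc)
  have q: "lvar k * q = exchange_binomial N b1 k (lvar(j := p))"
    by (simp add: q_def flip: mult.assoc)
  obtain r where r: "p * r = exchange_binomial N b2 j (lvar(j := p, k := q))"
    and r_dep: "\<And>x x' :: nat \<Rightarrow> laurent fract. (\<And>i. x i \<noteq> 0) \<Longrightarrow> (\<And>i. x' i \<noteq> 0) \<Longrightarrow>
       (\<And>i. i \<noteq> j \<Longrightarrow> x i = x' i) \<Longrightarrow>
       laurent_eval x p = 0 \<Longrightarrow> laurent_eval x' p = 0 \<Longrightarrow> exchange_binomial N b1 k (x(j := 0)) \<noteq> 0 \<Longrightarrow>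
       laurent_eval x r = 0 \<Longrightarrow> laurent_eval x' r = 0 \<Longrightarrow> x j = x' j"
    using exchange_binomial_three_steps[OF jk nN skew bkj, folded b1_def, folded b2_def, OF p q] by metis
  define x1 x2 x3 where "x1 = mutated_vars N b j ?X" and "x2 = mutated_vars N b1 k x1"
      and "x3 = mutated_vars N b2 j x2"
  have pos1: "positive_at_1 (x1 i)" and pos2: "positive_at_1 (x2 i)" and pos3: "positive_at_1 (x3 i)" for i
    unfolding x3_def x2_def x1_def by (auto intro!: positive_at_1_mutated_vars)
  have nz: "x1 i \<noteq> 0" "x2 i \<noteq> 0" "x3 i \<noteq> 0" for i
    using pos1 pos2 pos3 positive_at_1_nonzero by blast+
  have "lfr (exchange_binomial N b j lvar) = exchange_binomial N b j ?X"
    by (simp add: to_fract_exchange_binomial)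
  then have "lfr (lvar j) * lfr p = exchange_binomial N b j ?X"
    by (simp flip: p)
  then have "exchange_binomial N b j ?X / ?X j = lfr p"
    by (metis nonzero_mult_div_cancel_left lvar_nonzero to_fract_eq_0_iff)
  then have x1: "x1 = ?X(j := lfr p)"
    by (simp add: x1_def mutated_vars_def)
  have "lfr (exchange_binomial N b1 k (lvar(j := p))) = exchange_binomial N b1 k x1"
    unfolding to_fract_exchange_binomial x1 by (rule exchange_binomial_cong) auto
  then have "lfr (lvar k) * lfr q = exchange_binomial N b1 k x1"
    by (simp flip: q)
  then have "exchange_binomial N b1 k x1 / ?X k = lfr q"
    by (metis nonzero_mult_div_cancel_left lvar_nonzero to_fract_eq_0_iff)
  then have x2: "x2 = ?X(j := lfr p, k := lfr q)"
    using jk by (simp add: x2_def mutated_vars_def) (simp add: x1)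
  have p0: "p \<noteq> 0"
    using nz(1)[of j] x1 by auto
  have "lfr (exchange_binomial N b2 j (lvar(j := p, k := q))) = exchange_binomial N b2 j x2"
    unfolding to_fract_exchange_binomial x2 by (rule exchange_binomial_cong) auto
  then have "lfr p * lfr r = exchange_binomial N b2 j x2"
    by (simp flip: r)
  then have "exchange_binomial N b2 j x2 / lfr p = lfr r"
    by (metis nonzero_mult_div_cancel_left p0 to_fract_eq_0_iff)
  moreover have "x2 j = lfr p"
    using jk by (simp add: x2)
  ultimately have "x3 = x2(j := lfr r)"
    by (simp add: x3_def mutated_vars_def)
  then have x3: "x3 = ?X(j := lfr r, k := lfr q)"
    using jk by (auto simp: x2)
  have q0: "q \<noteq> 0" and r0: "r \<noteq> 0"
    using nz(3)[of k] nz(3)[of j] jk x3 by auto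
  have y1: "vars_along N b ?X (j # k # ks) = vars_along N b1 x1 (k # ks)"
    by (simp add: b1_def x1_def)
  \<comment> \<open>Mutating \<open>x3\<close> back in direction \<open>j\<close> gives
    \<open>x2\<close>, so the end of the path is also reached from \<open>x3\<close> along the
    shorter path \<open>j # ks\<close>.\<close>
  have "mutated_vars N b3 j x3 = x2"
    unfolding b3_def x3_def
    by (rule mutated_vars_involution)
        (use diag nz positive_at_1_nonzero[OF positive_at_1_exchange_binomial[OF pos2]] in auto)
  moreover have "mutated_entry b3 j = b2"
    by (simp add: b3_def)
  ultimately have y3: "vars_along N b ?X (j # k # ks) = vars_along N b3 x3 (j # ks)"
    by (simp flip: b1_def x1_def b2_def x2_def)
  \<comment> \<open>The induction hypothesis speaks of independent variables. It is specialized to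
    \<open>x1\<close> and \<open>x3\<close>; positivity at 1 keeps all variables on the way
    nonzero.\<close>
  have transport: "\<exists>G. G \<in> partial_laurent n \<and> vars_along N b' x ks' i = laurent_eval x G"
    if "skew_symmetrizable n b'" "\<And>i. positive_at_1 (x i)" "set ks' \<subseteq> {1..n}" "length ks' < length (j # k # ks)"
      "i \<in> {1..N}" for b' ks' i and x :: "nat \<Rightarrow> laurent fract"
  proof -
    have "laurent_along n N b' ks'"
      by (rule IH) fact+
    then obtain G where G: "\<And>i. i \<in> {1..N} \<Longrightarrow> vars_along N b' ?X ks' i = lfr (G i)"
      and Gi: "\<And>i. i \<in> {1..N} \<Longrightarrow> G i \<in> partial_laurent n"
      unfolding laurent_along_def image_iff by metis
    have "vars_along N b' x ks' i = laurent_eval x (G i)"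
    proof (rule laurent_along_transport[OF nN that(3)])
      show "x i \<noteq> 0" for i
        using that(2) positive_at_1_nonzero by blast
      show "laurent_along n N b' (take s ks')" if "s < length ks'" for s
        using that set_take_subset[of s ks'] \<open>set ks' \<subseteq> {1..n}\<close> \<open>length ks' < length (j # k # ks)\<close>
        by (intro IH) (auto intro: \<open>skew_symmetrizable n b'\<close>)
      show "vars_along N b' x (take s ks') i \<noteq> 0" for s i
        by (rule positive_at_1_nonzero[OF positive_at_1_vars_along]) fact
    qed (use G that in auto)
    then show ?thesis
      using Gi that(5) by blast
  qed
  define a1 a0 where "a1 = (\<Prod>i\<in>{1..N} - {z}. lvar i ^ nat (b i j))"
    and "a0 = (\<Prod>i\<in>{1..N} - {z}. lvar i ^ nat (- b i j))"
  have remove_z: "(\<Prod>i\<in>{1..N}. g i) = g z * (\<Prod>i\<in>{1..N} - {z}. g i)" for g :: "nat \<Rightarrow> laurent"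
    using z by (intro prod.remove) auto
  have ez: "exchange_binomial N b j lvar = lvar z * a1 + a0"
    unfolding exchange_binomial_def remove_z a1_def a0_def using z by simp
  obtain a1' where inv1: "a1 * a1' = 1"
    using lvar_prod_inverse[of "\<lambda>i. nat (b i j)" "{1..N} - {z}"] unfolding a1_def by blast
  obtain a0' where inv0: "a0 * a0' = 1"
    using lvar_prod_inverse[of "\<lambda>i. nat (- b i j)" "{1..N} - {z}"] unfolding a0_def by blast
  note inv = inv1 inv0
  \<comment> \<open>The zero in \<open>z\<close> of \<open>lvar z * a1 + a0\<close>; it is a unit
    because \<open>a0\<close> and \<open>a1\<close> are monomials.\<close>
  define w where "w = - a0 * a1'"
  have "w * (- a0' * a1) = (a0 * a0') * (a1 * a1')"
    by (simp add: w_def mult_ac)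
  then have w: "w * (- a0' * a1) = 1"
    by (simp only: inv mult_1_left)
  then have w0: "w \<noteq> 0" by auto
  have zw: "lvar z - w = p * (lvar j * a1')"
  proof -
    have "p * (lvar j * a1') = (lvar j * p) * a1'"
      by (simp add: mult_ac)
    also have "\<dots> = lvar z * (a1 * a1') + a0 * a1'"
      unfolding p ez by (simp add: algebra_simps)
    finally show ?thesis
      by (simp add: w_def inv)
  qed
  define \<sigma> where "\<sigma> = ?X(z := lfr w)"
  have \<sigma>0: "\<sigma> i \<noteq> 0" for i
    using w0 by (simp add: \<sigma>_def)
  have zjk: "z \<noteq> j" "z \<noteq> k"
    using z jk by auto
  have exch_\<sigma>: "exchange_binomial N b j \<sigma> = 0"
  proof -
    have "exchange_binomial N b j \<sigma> = lfr (exchange_binomial N b j (lvar(z := w)))"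
      unfolding to_fract_exchange_binomial by (rule exchange_binomial_cong) (auto simp: \<sigma>_def)
    also have "exchange_binomial N b j (lvar(z := w)) = w * a1 + a0"
    proof -
      have "(\<Prod>i\<in>{1..N} - {z}. (lvar(z := w)) i ^ f i) = (\<Prod>i\<in>{1..N} - {z}. lvar i ^ f i)" for f :: "nat \<Rightarrow> nat"
        by (rule prod.cong) auto
      then show ?thesis
        unfolding exchange_binomial_def remove_z a1_def a0_def using z by simp
    qed
    also have "\<dots> = 0"
      using inv(1) by (simp add: w_def mult.assoc mult.commute[of a1'])
    finally show ?thesis by simp
  qed
  \<comment> \<open>As \<open>b j j = 0\<close>, the vanishing of \<open>p\<close> does not depend
    on the coordinate at \<open>j\<close>. This freedom is used below for \<open>r\<close>.\<close>
  have eval_p: "laurent_eval x p = 0" if "\<And>i. x i \<noteq> 0" "\<And>i. i \<noteq> j \<Longrightarrow> x i = \<sigma> i" for x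
  proof -
    have "laurent_eval x (lvar j * p) = exchange_binomial N b j x"
      unfolding p by (simp add: laurent_eval_exchange_binomial that)
    also have "\<dots> = exchange_binomial N b j \<sigma>"
    proof (rule exchange_binomial_cong)
      show "x i = \<sigma> i" if "b i j \<noteq> 0" for i
        using that diag(1) \<open>\<And>i. i \<noteq> j \<Longrightarrow> x i = \<sigma> i\<close> by metis
    qed simp
    finally show ?thesis
      using that by (simp add: exch_\<sigma> laurent_eval_mult)
  qed
  have b1jk: "b1 j k \<ge> 0" and b1zk: "b1 z k = 0"
  proof -
    have "sgn (b j k) = - sgn (b k j)"
      by (rule skew_symmetrizable_sgn[OF skew]) (use jk in auto)
    then have "b j k \<le> 0"
      using bkj by (auto simp: sgn_if split: if_splits)
    then show "b1 j k \<ge> 0" "b1 z k = 0"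
      using z jk zjk by (auto simp: b1_def mutated_entry_def)
  qed
  \<comment> \<open>If \<open>x j\<close> is absent from the binomial, it is the generic one, since
    \<open>z\<close> is absent too. Otherwise the value 0 at \<open>j\<close> kills exactly one of
    the two monomials.\<close>
  have Q: "exchange_binomial N b1 k (\<sigma>(j := 0)) \<noteq> 0"
  proof (cases "b1 j k = 0")
    case True
    have "exchange_binomial N b1 k (\<sigma>(j := 0)) = exchange_binomial N b1 k ?X"
      by (rule exchange_binomial_cong) (use True b1zk in \<open>auto simp: \<sigma>_def\<close>)
    then show ?thesis
      using positive_at_1_nonzero[OF positive_at_1_exchange_binomial[of ?X]] by simp
  next
    case False
    then have "nat (b1 j k) > 0" "nat (- b1 j k) = 0"
      using b1jk by auto
    then show ?thesis
      unfolding exchange_binomial_split[of j k N b1, OF jk(1) jkN diag(2)]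
          by (simp only: fun_upd_same zero_power) (simp add: \<sigma>0)
  qed
  have eval_q: "laurent_eval \<sigma> q \<noteq> 0"
  proof
    assume "laurent_eval \<sigma> q = 0"
    then have "laurent_eval \<sigma> (lvar k * q) = 0"
      by (simp add: laurent_eval_mult \<sigma>0)
    moreover have "laurent_eval \<sigma> (lvar k * q) = exchange_binomial N b1 k (\<sigma>(j := 0))"
      unfolding q laurent_eval_exchange_binomial[OF \<sigma>0]
      by (rule exchange_binomial_cong) (auto simp: eval_p[of \<sigma>, OF \<sigma>0])
    ultimately show False
      using Q by simp
  qed
  have kernel: "p dvd h" if "laurent_eval \<sigma> h = 0" for h
    using laurent_eval_kernel[OF w zw] that by (simp add: \<sigma>_def)
  have eval_r: "laurent_eval \<sigma> r \<noteq> 0"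
  proof
    text \<open>A multiple of \<open>p\<close> would vanish at \<open>\<sigma>\<close> whatever value is given to the \<open>j\<close>-th coordinate.\<close>
    assume r\<sigma>: "laurent_eval \<sigma> r = 0"
    then obtain r' where r': "r = p * r'"
      using kernel by blast
    let ?\<tau> = "\<sigma>(j := 1)"
    have \<tau>0: "?\<tau> i \<noteq> 0" for i
      using \<sigma>0 by simp
    have p\<tau>: "laurent_eval ?\<tau> p = 0"
      by (rule eval_p[OF \<tau>0]) simp
    then have "laurent_eval ?\<tau> r = 0"
      unfolding r' laurent_eval_mult[of ?\<tau>, OF \<tau>0] by simp
    then have "\<sigma> j = ?\<tau> j"
      by (intro r_dep[of \<sigma> ?\<tau>, OF \<sigma>0 \<tau>0 _ eval_p[OF \<sigma>0] p\<tau> Q r\<sigma>]) auto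
    then have "lfr (lvar j) = 1"
      using zjk by (simp add: \<sigma>_def)
    then have "lvar j = 1"
      by (metis to_fract_1 to_fract_eq_iff)
    then have "laurent_eval (\<lambda>_. 2::rat) (lvar j) = laurent_eval (\<lambda>_. 2) 1"
      by simp
    then show False by simp
  qed
  have p_in: "p \<in> partial_laurent n"
  proof -
    interpret subring_in_field "lfr ` partial_laurent n"
      by (rule subring_partial_laurent)
    have "lfr (exchange_binomial N b j lvar) \<in> lfr ` partial_laurent n"
      unfolding to_fract_exchange_binomial by (rule exchange_binomial_in) (simp add: partial_laurent_lvar)
    then have "exchange_binomial N b j lvar \<in> partial_laurent n"
      by (auto simp: image_iff)
    then show ?thesis
      unfolding p_def using jk by (intro partial_laurent_mult partial_laurent_linv) auto
  qed
  show ?thesis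
    unfolding laurent_along_def
  proof
    fix i
    assume i: "i \<in> {1..N}"
    let ?y = "vars_along N b ?X (j # k # ks) i"
    have "\<exists>G. G \<in> partial_laurent n \<and> vars_along N b1 x1 (k # ks) i = laurent_eval x1 G"
      by (rule transport[of b1 x1, OF skew'(1) pos1]) (use i jk ks in auto)
    then obtain G1 where G1: "G1 \<in> partial_laurent n" "?y = laurent_eval x1 G1"
      unfolding y1 by blast
    have "\<exists>G. G \<in> partial_laurent n \<and> vars_along N b3 x3 (j # ks) i = laurent_eval x3 G"
      by (rule transport[of b3 x3, OF skew'(3) pos3]) (use i jk ks in auto)
    then obtain G3 where G3: "G3 \<in> partial_laurent n" "?y = laurent_eval x3 G3"
      unfolding y3 by blast
    interpret P: subring_in_field "lfr ` partial_laurent n"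
      by (rule subring_partial_laurent)
    interpret A: subring_in_field "range lfr"
      by (rule subring_range_lfr)
    \<comment> \<open>The only new denominator in \<open>x1\<close> is \<open>p\<close>, so a power
      of \<open>p\<close> clears it without introducing frozen denominators.\<close>
    have "\<exists>a. lfr p ^ a * laurent_eval x1 G1 \<in> lfr ` partial_laurent n"
    proof (rule P.clear_laurent_eval[OF _ nz(1) _ _ G1(1)])
      show "lfr p / x1 i \<in> lfr ` partial_laurent n" if "i \<le> n" for i
      proof (cases "i = j")
        case True
        then show ?thesis
          using p0 P.one_in by (simp add: x1)
      next
        case False
        then have "lfr p / x1 i = lfr (p * linv i)"
          by (simp add: x1 lfr_linv divide_inverse)
        then show ?thesis
          using partial_laurent_mult[OF p_in partial_laurent_linv[OF that]] by (simp only: imageI)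
      qed
    qed (auto simp: x1 p_in partial_laurent_lvar)
    then obtain a where a: "lfr p ^ a * ?y \<in> lfr ` partial_laurent n"
      unfolding G1(2) by blast
    \<comment> \<open>Here frozen denominators are tolerated; they are excluded at the end by means
      of \<open>p\<close>.\<close>
    have "\<exists>c. lfr (q * r) ^ c * laurent_eval x3 G3 \<in> range lfr"
    proof (rule A.clear_laurent_eval[OF _ nz(3) _ _ G3(1)])
      show "lfr (q * r) / x3 i \<in> range lfr" for i
      proof -
        have "lfr (q * r) / x3 i = (if i = k then lfr r else if i = j then lfr q else lfr (q * r * linv i))"
          using q0 r0 by (simp add: x3 lfr_linv divide_inverse)
        then show ?thesis by (metis rangeI)
      qed
    qed (auto simp: x3 simp flip: to_fract_mult)
    then obtain c where c: "lfr (q * r) ^ c * ?y \<in> range lfr"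
      unfolding G3(2) by blast
    have qr: "laurent_eval \<sigma> (q * r) \<noteq> 0"
      using eval_q eval_r by (simp add: laurent_eval_mult \<sigma>0)
    have pa: "lfr p ^ a * ?y \<in> range lfr"
      using a by blast
    have "?y \<in> range lfr"
      by (rule laurent_descent[OF \<sigma>0 kernel eval_p[of \<sigma>, OF \<sigma>0] p0 qr c pa]) auto
    then obtain Y where Y: "?y = lfr Y" by blast
    \<comment> \<open>The factors \<open>p\<close> are stripped off one by one:
      \<open>lvar j * p\<close> is the exchange binomial, which can be cancelled because it contains
      \<open>z\<close>.\<close>
    have "p ^ a * Y \<in> partial_laurent n"
      using a unfolding Y by (auto simp: image_iff simp flip: to_fract_power to_fract_mult)
    then have "Y \<in> partial_laurent n"
    proof (induction a)
      case (Suc a)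
      have "exchange_binomial N b j lvar * (p ^ a * Y) = lvar j * (p ^ Suc a * Y)"
        by (simp add: mult_ac flip: p)
      also have "\<dots> \<in> partial_laurent n"
        by (rule partial_laurent_mult[OF partial_laurent_lvar Suc.prems])
      finally have "p ^ a * Y \<in> partial_laurent n"
        by (rule exchange_binomial_lvar_cancel[of N b j _ n z]) (use z in auto)
      then show ?case
        by (rule Suc.IH)
    qed simp
    then show "?y \<in> lfr ` partial_laurent n"
      unfolding Y by blast
  qed
qed

text \<open>The generic situation is reached by attaching a frozen variable to column \<open>j\<close>, and is left
  again by specializing it to 1.\<close>

lemma laurent_along_step:
  assumes jk: "j \<noteq> k" "j \<in> {1..n}" "k \<in> {1..n}" and ks: "set ks \<subseteq> {1..n}" and nN: "n \<le> N"
    and skew: "skew_symmetrizable n b" and bkj: "b k j \<ge> 0"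
    and IH: "\<And>N b' ks'. n \<le> N \<Longrightarrow> skew_symmetrizable n b' \<Longrightarrow> set ks' \<subseteq> {1..n} \<Longrightarrow>
      length ks' < length (j # k # ks) \<Longrightarrow> laurent_along n N b' ks'"
  shows "laurent_along n N b (j # k # ks)"
proof -
  let ?ks = "j # k # ks" and ?X = "\<lambda>i. lfr (lvar i)"
  \<comment> \<open>The new row is the unit vector at \<open>j\<close>, so the new frozen variable
    is attached to \<open>j\<close> alone.\<close>
  define b' where "b' = (\<lambda>i l. if i = Suc N then (if l = j then 1 else 0) else b i l)"
  have skew': "skew_symmetrizable n b'"
  proof -
    have "b' i l = b i l" if "i \<in> {1..n}" for i l
      using that nN by (simp add: b'_def)
    then have "skew_symmetrizable n b' = skew_symmetrizable n b"
      unfolding skew_symmetrizable_def by (simp only: cong: ball_cong)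
    then show ?thesis using skew by simp
  qed
  have set: "set ?ks \<subseteq> {1..n}"
    using jk ks by simp
  have gen: "laurent_along n (Suc N) b' ?ks"
    by (rule laurent_along_generic_step[OF jk ks skew', where z = "Suc N"])
      (use bkj jk nN IH[of "Suc N"] in \<open>auto simp: b'_def\<close>)
  then obtain G where G: "\<And>i. i \<in> {1..Suc N} \<Longrightarrow> vars_along (Suc N) b' ?X ?ks i = lfr (G i)"
    and Gi: "\<And>i. i \<in> {1..Suc N} \<Longrightarrow> G i \<in> partial_laurent n"
    unfolding laurent_along_def image_iff by metis
  define x where "x = ?X(Suc N := 1)"
  have posx: "positive_at_1 (x i)" for i
    by (simp add: x_def)
  then have x0: "x i \<noteq> 0" for i
    by (rule positive_at_1_nonzero)
  interpret subring_in_field "lfr ` partial_laurent n"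
    by (rule subring_partial_laurent)
  show ?thesis
    unfolding laurent_along_def
  proof
    fix i
    assume i: "i \<in> {1..N}"
    have "vars_along N b ?X ?ks i = vars_along (Suc N) b' x ?ks i"
      by (rule vars_along_cong[symmetric, OF nN set]) (use nN i in \<open>auto simp: b'_def x_def\<close>)
    also have "\<dots> = laurent_eval x (G i)"
    proof (rule laurent_along_transport[OF _ set x0])
      show "laurent_along n (Suc N) b' (take s ?ks)" if "s < length ?ks" for s
        by (rule IH) (use that set set_take_subset[of s ?ks] nN skew' in auto)
      show "vars_along (Suc N) b' x (take s ?ks) i \<noteq> 0" for s i
        by (rule positive_at_1_nonzero[OF positive_at_1_vars_along[OF posx]])
    qed (use nN i G in auto)
    finally have eq: "vars_along N b ?X ?ks i = laurent_eval x (G i)" .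
    \<comment> \<open>The mutable coordinates of \<open>x\<close> are already invertible in the
      ring, so \<open>d = 1\<close> clears all denominators.\<close>
    have "\<exists>a. 1 ^ a * laurent_eval x (G i) \<in> lfr ` partial_laurent n"
    proof (rule clear_laurent_eval[OF _ x0])
      show "1 / x i \<in> lfr ` partial_laurent n" if "i \<le> n" for i
        using that nN partial_laurent_linv[OF that]
        by (auto simp: x_def divide_inverse simp flip: lfr_linv)
    qed (use one_in i Gi partial_laurent_lvar in \<open>auto simp: x_def\<close>)
    then show "vars_along N b ?X ?ks i \<in> lfr ` partial_laurent n"
      unfolding eq by simp
  qed
qed

text \<open>Strong induction on the path length, for all \<open>N\<close> at once because the step
  adds a frozen variable. Immediate backtracking shortens the path; the sign of \<open>b k j\<close>
  is adjusted by passing to the negated matrix.\<close>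

lemma laurent_phenomenon:
  assumes "n \<le> N" "skew_symmetrizable n b" "set ks \<subseteq> {1..n}"
  shows "laurent_along n N b ks"
  using assms
proof (induction "length ks" arbitrary: N b ks rule: less_induct)
  case less
  let ?X = "\<lambda>i. lfr (lvar i)"
  have var: "lfr (lvar i) \<in> lfr ` partial_laurent n" for i
    using partial_laurent_lvar by blast
  consider "ks = []" | j where "ks = [j]" | j k ks' where "ks = j # k # ks'"
    by (metis list.exhaust)
  then show ?case
  proof cases
    case 1
    then show ?thesis
      by (simp add: laurent_along_def var)
  next
    case (2 j)
    interpret subring_in_field "lfr ` partial_laurent n"
      by (rule subring_partial_laurent)
    have "exchange_binomial N b j ?X * lfr (linv j) \<in> lfr ` partial_laurent n"
      using less.prems 2 by (intro mult_in exchange_binomial_in var) (auto intro: partial_laurent_linv)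
    then show ?thesis
      using 2 by (simp add: laurent_along_def mutated_vars_def var lfr_linv divide_inverse)
  next
    case (3 j k ks')
    have jk: "j \<in> {1..n}" "k \<in> {1..n}" "set ks' \<subseteq> {1..n}"
      using less.prems 3 by auto
    have IH: "laurent_along n N' b' l"
      if "n \<le> N'" "skew_symmetrizable n b'" "set l \<subseteq> {1..n}" "length l < length (j # k # ks')" for N' b' l
      using less.hyps[of l N' b'] that 3 by simp
    show ?thesis
    proof (cases "j = k")
      case True
      have "mutated_vars N (mutated_entry b j) j (mutated_vars N b j ?X) = ?X"
        using skew_symmetrizable_diag[OF less.prems(2) jk(1)]
            positive_at_1_nonzero[OF positive_at_1_exchange_binomial[of ?X]]
        by (intro mutated_vars_involution) auto
      then have "vars_along N b ?X ks = vars_along N b ?X ks'"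
        using True 3 by simp
      then show ?thesis
        using less.hyps[of ks' N b] less.prems 3 jk by (simp add: laurent_along_def)
    next
      case False
      show ?thesis
      proof (cases "b k j \<ge> 0")
        case True
        show ?thesis
          unfolding 3 by (rule laurent_along_step[OF False jk less.prems(1,2) True IH])
      next
        case neg: False
        have "laurent_along n N (\<lambda>i j. - b i j) (j # k # ks')"
          by (rule laurent_along_step[OF False jk less.prems(1) _ _ IH])
            (use neg less.prems skew_symmetrizable_uminus in auto)
        then show ?thesis
          unfolding laurent_along_def vars_along_uminus 3 .
      qed
    qed
  qed
qed

section \<open>Normal Noetherian domains\<close>

lemma alg_of_simps [simp]:
  "carrier (alg_of R sc) = R" "x \<otimes>\<^bsub>alg_of R sc\<^esub> y = x * y" "\<one>\<^bsub>alg_of R sc\<^esub> = 1"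
  "\<zero>\<^bsub>alg_of R sc\<^esub> = 0" "x \<oplus>\<^bsub>alg_of R sc\<^esub> y = x + y" "c \<odot>\<^bsub>alg_of R sc\<^esub> x = sc c x"
  by (simp_all add: alg_of_def)

lemma integral_overI:
  fixes y :: "'k::field"
  assumes "y ^ n = (\<Sum>i<n. r i * y ^ i)" "\<And>i. r i \<in> R" "0 \<in> R" "1 \<in> R" "\<And>a. a \<in> R \<Longrightarrow> - a \<in> R"
  shows "integral_over R y"
proof -
  define f where "f = monom 1 n - (\<Sum>i<n. monom (r i) i)"
  have coeff_f: "coeff f i = (if i = n then 1 else if i < n then - r i else 0)" for i
    by (auto simp: f_def coeff_sum coeff_diff)
  have "degree f = n"
    by (rule antisym) (auto intro: degree_le le_degree simp: coeff_f)
  then have "lead_coeff f = 1"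
    by (simp add: coeff_f)
  moreover have "\<forall>i. coeff f i \<in> R"
    using assms by (simp add: coeff_f)
  moreover have "poly f y = 0"
    by (simp add: f_def poly_sum poly_monom assms(1))
  ultimately show ?thesis
    unfolding integral_over_def by blast
qed

locale noetherian_normal =
  fixes R :: "'k::field set" and sc :: "complex \<Rightarrow> 'k \<Rightarrow> 'k"
  assumes normal_noetherian: "noetherian_normal_domain_algebra R sc"
begin

abbreviation A :: "(complex, 'k) module" where
  "A \<equiv> alg_of R sc"

sublocale algebra "ring_of_type_algebra :: complex ring" A
  using normal_noetherian by (simp add: noetherian_normal_domain_algebra_def)

sublocale noetherian_domain A
  using normal_noetherian by (simp add: noetherian_normal_domain_algebra_def)

sublocale subring_in_field R
proof
  show "1 \<in> R"
    using one_closed by simp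
  show "a + c \<in> R" "a * c \<in> R" if "a \<in> R" "c \<in> R" for a c
    using that add.m_closed[of a c] m_closed[of a c] by simp_all
  show "- a \<in> R" if "a \<in> R" for a
  proof -
    have "a + (\<ominus>\<^bsub>A\<^esub> a) = 0" "\<ominus>\<^bsub>A\<^esub> a \<in> R"
      using that r_neg[of a] a_inv_closed[of a] by simp_all
    then show ?thesis
      by (simp add: add_eq_0_iff)
  qed
qed

lemma a_inv_eq: "a \<in> R \<Longrightarrow> \<ominus>\<^bsub>A\<^esub> a = - a"
  using r_neg[of a] by (simp add: add_eq_0_iff)

lemma ideal_alg_ofI:
  assumes "I \<subseteq> R" "0 \<in> I" "\<And>a c. a \<in> I \<Longrightarrow> c \<in> I \<Longrightarrow> a + c \<in> I"
    and "\<And>s a. s \<in> R \<Longrightarrow> a \<in> I \<Longrightarrow> s * a \<in> I"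
  shows "ideal I A"
proof (rule idealI)
  show "ring A" by (rule ring_axioms)
  show "subgroup I (add_monoid A)"
  proof
    show "inv\<^bsub>add_monoid A\<^esub> a \<in> I" if "a \<in> I" for a
      using assms(4)[OF uminus_in[OF one_in] that] that assms(1) a_inv_eq[of a]
      by (auto simp: a_inv_def)
  qed (use assms in auto)
  show "x \<otimes>\<^bsub>A\<^esub> a \<in> I" "a \<otimes>\<^bsub>A\<^esub> x \<in> I" if "a \<in> I" "x \<in> carrier A" for a x
    using assms(4)[of x a] that by (simp_all add: mult.commute)
qed

lemma ideal_alg_ofD:
  assumes "ideal I A"
  shows "I \<subseteq> R" "0 \<in> I" "\<And>s a. s \<in> R \<Longrightarrow> a \<in> I \<Longrightarrow> s * a \<in> I"
  using ideal.Icarr[OF assms] additive_subgroup.zero_closed[OF ideal.axioms(1)[OF assms]]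
    ideal.I_l_closed[OF assms] by auto

text \<open>The ideals generated by \<open>q, q y, \<dots>, q y ^ (n - 1)\<close> become stationary.\<close>

lemma in_R_if_powers_in_R:
  assumes "q \<noteq> 0" and q: "\<And>i. q * y ^ i \<in> R"
  shows "y \<in> R"
proof -
  define J where "J n = {\<Sum>i<n. r i * (q * y ^ i) | r. \<forall>i. r i \<in> R}" for n :: nat
  have J_ideal: "ideal (J n) A" for n
  proof (rule ideal_alg_ofI)
    show "J n \<subseteq> R"
      unfolding J_def using q by (auto intro!: sum_in mult_in[of _ "q * _"])
    show "0 \<in> J n"
      unfolding J_def using zero_in by (auto intro!: exI[of _ "\<lambda>_. 0"])
    show "a + c \<in> J n" if "a \<in> J n" "c \<in> J n" for a c
    proof -
      obtain r r' where r: "\<forall>i. r i \<in> R" "\<forall>i. r' i \<in> R"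
        and "a = (\<Sum>i<n. r i * (q * y ^ i))" "c = (\<Sum>i<n. r' i * (q * y ^ i))"
        using \<open>a \<in> J n\<close> \<open>c \<in> J n\<close> unfolding J_def by blast
      then have "a + c = (\<Sum>i<n. (r i + r' i) * (q * y ^ i))"
        by (simp add: distrib_right sum.distrib)
      then show ?thesis
        unfolding J_def using r add_in by (auto intro!: exI[of _ "\<lambda>i. r i + r' i"])
    qed
    show "s * a \<in> J n" if "s \<in> R" "a \<in> J n" for s a
    proof -
      obtain r where r: "\<forall>i. r i \<in> R" and "a = (\<Sum>i<n. r i * (q * y ^ i))"
        using \<open>a \<in> J n\<close> unfolding J_def by blast
      then have "s * a = (\<Sum>i<n. (s * r i) * (q * y ^ i))"
        by (simp add: sum_distrib_left mult.assoc)
      then show ?thesis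
        unfolding J_def using r that mult_in by (auto intro!: exI[of _ "\<lambda>i. s * r i"])
    qed
  qed
  have J_mono: "J m \<subseteq> J n" if "m \<le> n" for m n
  proof
    fix a assume "a \<in> J m"
    then obtain r where r: "\<forall>i. r i \<in> R" and a: "a = (\<Sum>i<m. r i * (q * y ^ i))"
      unfolding J_def by blast
    have "a = (\<Sum>i<n. (if i < m then r i else 0) * (q * y ^ i))"
      unfolding a using that by (intro sum.mono_neutral_cong_left) auto
    then show "a \<in> J n"
      unfolding J_def using r zero_in by (auto intro!: exI[of _ "\<lambda>i. if i < m then r i else 0"])
  qed
  have "J m \<subseteq> J n \<or> J n \<subseteq> J m" for m n
    using J_mono nat_le_linear by blast
  then have "\<forall>I\<in>range J. \<forall>I'\<in>range J. I \<subseteq> I' \<or> I' \<subseteq> I"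
    by blast
  moreover have "range J \<subseteq> {I. ideal I A}"
    using J_ideal by blast
  ultimately have "subset.chain {I. ideal I A} (range J)"
    unfolding subset_chain_def by (intro conjI)
  then have "\<Union> (range J) \<in> range J"
    using ideal_chain_is_trivial[of "range J"] by blast
  then obtain n where n: "\<Union> (range J) = J n"
    by blast
  \<comment> \<open>The last generator of \<open>J (Suc n)\<close> already lies in
    \<open>J n\<close>; cancelling \<open>q\<close> leaves a monic equation of degree
    \<open>n\<close> for \<open>y\<close>.\<close>
  have "q * y ^ n \<in> J (Suc n)"
    unfolding J_def using zero_in one_in
    by (auto intro!: exI[of _ "\<lambda>i. if i = n then 1 else 0"])
  then have "q * y ^ n \<in> J n"
    using n by blast
  then obtain r where r: "\<forall>i. r i \<in> R" and "q * y ^ n = (\<Sum>i<n. r i * (q * y ^ i))"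
    unfolding J_def by blast
  then have "q * y ^ n = q * (\<Sum>i<n. r i * y ^ i)"
    by (simp add: sum_distrib_left mult_ac)
  then have y: "y ^ n = (\<Sum>i<n. r i * y ^ i)"
    using assms(1) by simp
  have "integral_over R y"
    by (rule integral_overI[OF y]) (use r zero_in one_in uminus_in in auto)
  then show ?thesis
    using normal_noetherian by (simp add: noetherian_normal_domain_algebra_def integrally_closed_def)
qed

text \<open>All \<open>q * y ^ i\<close> stay in \<open>I\<close>, so \<open>y\<close> is almost
  integral, and a normal Noetherian domain contains its almost integral elements.\<close>

lemma in_R_if_stable_subset:
  assumes "I \<subseteq> R" "q \<in> I" "q \<noteq> 0" and "\<And>a. a \<in> I \<Longrightarrow> a * y \<in> I"
  shows "y \<in> R"
proof (rule in_R_if_powers_in_R[OF assms(3)])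
  fix i
  have "q * y ^ i \<in> I"
  proof (induction i)
    case (Suc i)
    have "q * y ^ i * y \<in> I"
      by (rule assms(4)[OF Suc])
    then show ?case
      by (simp add: mult_ac)
  qed (use assms in simp)
  then show "q * y ^ i \<in> R"
    using assms(1) by blast
qed

section \<open>Primes of height one as denominator ideals\<close>

lemma zero_primeideal: "primeideal {0} A"
proof (rule primeidealI)
  show "ideal {0} A"
    by (rule ideal_alg_ofI) (use zero_in in auto)
  show "cring A"
    by (rule is_cring)
  show "carrier A \<noteq> {0}"
    using one_in by auto
qed auto

text \<open>In a chain with two or more steps the term just below \<open>P\<close> would be
  \<open>{0}\<close>, leaving no room for a smaller prime.\<close>

lemma prime_height_eq_1:
  assumes P: "primeideal P A" "P \<noteq> {0}"
    and min: "\<And>Q. primeideal Q A \<Longrightarrow> Q \<subset> P \<Longrightarrow> Q = {0}"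
  shows "prime_height A P = 1"
proof -
  let ?L = "{l. \<exists>Q :: nat \<Rightarrow> 'k set. (\<forall>i\<le>l. primeideal (Q i) A) \<and>
                  (\<forall>i<l. Q i \<subset> Q (Suc i)) \<and> Q l = P}"
  have zero: "0 \<in> Q" if "primeideal Q A" for Q
    using ideal_alg_ofD(2) that primeideal.axioms(1) by blast
  have "1 \<in> ?L"
  proof -
    have "{0} \<subset> P"
      using P zero by blast
    then show ?thesis
      using P zero_primeideal by (auto intro!: exI[of _ "\<lambda>i. if i = 0 then {0} else P"])
  qed
  moreover have "l \<le> 1" if "l \<in> ?L" for l
  proof (rule ccontr)
    assume l: "\<not> l \<le> 1"
    obtain Q :: "nat \<Rightarrow> 'k set" where Q: "\<And>i. i \<le> l \<Longrightarrow> primeideal (Q i) A"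
      "\<And>i. i < l \<Longrightarrow> Q i \<subset> Q (Suc i)" "Q l = P"
      using \<open>l \<in> ?L\<close> by blast
    obtain m where m: "l = Suc (Suc m)"
      using l by (cases l rule: nat.exhaust) (auto simp: gr0_conv_Suc)
    have "Q (Suc m) = {0}"
      using min[of "Q (Suc m)"] Q(1)[of "Suc m"] Q(2)[of "Suc m"] Q(3) m by simp
    moreover have "Q m \<subset> Q (Suc m)"
      using Q(2)[of m] m by simp
    moreover have "0 \<in> Q m"
      by (rule zero[OF Q(1)]) (simp add: m)
    ultimately show False by auto
  qed
  ultimately have "(SUP l\<in>?L. enat l) = enat 1"
    by (intro antisym SUP_least SUP_upper) auto
  then show ?thesis
    unfolding prime_height_def by (simp add: one_enat_def)
qed

text \<open>If \<open>\<pi>\<close> is an element of the maximal denominator ideal \<open>P\<close> of \<open>x\<close> with \<open>\<pi> x \<notin> P\<close>, then \<open>\<pi>\<close>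
  generates \<open>P\<close> locally, so a smaller prime is stable under multiplication by \<open>x\<close> and vanishes.\<close>

lemma height_one_denominator:
  assumes "y \<notin> R"
  obtains P r where "primeideal P A" "prime_height A P = 1" "r \<in> R" "P = {s \<in> R. s * (r * y) \<in> R}"
proof -
  define D where "D r = {s \<in> R. s * (r * y) \<in> R}" for r
  have D_ideal: "ideal (D r) A" for r
    by (rule ideal_alg_ofI)
      (auto simp: D_def distrib_right mult.assoc intro: zero_in add_in mult_in)
  define F where "F = D ` {r \<in> R. r * y \<notin> R}"
  \<comment> \<open>Chains of ideals contain their union by the Noetherian property, so Zorn's lemma
    applies.\<close>
  have "\<exists>M\<in>F. \<forall>I\<in>F. M \<subseteq> I \<longrightarrow> I = M"
  proof (rule subset_Zorn_nonempty)
    show "F \<noteq> {}"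
      using assms one_in by (force simp: F_def)
    fix C assume C: "C \<noteq> {}" "subset.chain F C"
    then have "subset.chain {I. ideal I A} C"
      using D_ideal unfolding subset_chain_def F_def by blast
    then have "\<Union> C \<in> C"
      using ideal_chain_is_trivial C by blast
    then show "\<Union> C \<in> F"
      using C unfolding subset_chain_def by blast
  qed
  then obtain r where r: "r \<in> R" "r * y \<notin> R"
    and max: "\<And>r'. r' \<in> R \<Longrightarrow> r' * y \<notin> R \<Longrightarrow> D r \<subseteq> D r' \<Longrightarrow> D r' = D r"
    unfolding F_def by blast
  define x P where "x = r * y" and "P = D r"
  have x: "x \<notin> R" and P: "P = {s \<in> R. s * x \<in> R}"
    using r by (auto simp: x_def P_def D_def)
  have prime: "primeideal P A"
  proof (rule primeidealI)
    show "ideal P A"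
      unfolding P_def by (rule D_ideal)
    show "cring A" by (rule is_cring)
    have "1 \<notin> P"
      using x by (simp add: P)
    then show "carrier A \<noteq> P"
      using one_in by auto
    fix a c assume ac: "a \<in> carrier A" "c \<in> carrier A" "a \<otimes>\<^bsub>A\<^esub> c \<in> P"
    \<comment> \<open>For \<open>a\<close> outside \<open>P\<close>, the element
      \<open>a * x\<close> is not in \<open>R\<close>, and its denominator ideal contains
      \<open>P\<close>, hence equals \<open>P\<close> by maximality; it contains
      \<open>c\<close>.\<close>
    show "a \<in> P \<or> c \<in> P"
    proof (cases "a \<in> P")
      case False
      then have "a * x \<notin> R"
        using ac by (simp add: P)
      moreover have "a * x = (a * r) * y"
        by (simp add: x_def mult_ac)
      moreover have "D r \<subseteq> D (a * r)"
      proof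
        fix s assume "s \<in> D r"
        then have s: "s \<in> R" "s * (r * y) \<in> R"
          by (simp_all add: D_def)
        have "a * (s * (r * y)) \<in> R"
          by (rule mult_in) (use ac s in simp_all)
        then show "s \<in> D (a * r)"
          using s(1) by (simp add: D_def ac_simps)
      qed
      ultimately have "D (a * r) = P"
        using max[of "a * r"] ac r by (simp add: P_def mult_in)
      moreover have "c \<in> D (a * r)"
        using ac by (simp add: D_def P x_def mult_ac)
      ultimately show ?thesis by blast
    qed simp
  qed
  obtain n d where nd: "n \<in> R" "d \<in> R" "d \<noteq> 0" "x = n / d"
    using normal_noetherian unfolding noetherian_normal_domain_algebra_def is_fraction_field_of_def by metis
  then have d: "d \<in> P"
    by (simp add: P)
  \<comment> \<open>If \<open>P\<close>, which contains the nonzero \<open>d\<close>, were stable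
    under multiplication by \<open>x\<close>, then \<open>x\<close> would be in
    \<open>R\<close>.\<close>
  obtain \<pi> where \<pi>: "\<pi> \<in> P" "\<pi> * x \<notin> P"
    using in_R_if_stable_subset[of P d x] d nd(3) x P by blast
  then have \<pi>R: "\<pi> \<in> R" "\<pi> * x \<in> R"
    by (auto simp: P)
  have "prime_height A P = 1"
  proof (rule prime_height_eq_1[OF prime])
    show "P \<noteq> {0}"
      using d nd by auto
    fix Q assume Q: "primeideal Q A" "Q \<subset> P"
    have QR: "Q \<subseteq> R" "\<And>s a. s \<in> R \<Longrightarrow> a \<in> Q \<Longrightarrow> s * a \<in> Q" "0 \<in> Q"
      using ideal_alg_ofD[OF primeideal.axioms(1)[OF Q(1)]] by blast+
    have Q_prime: "a \<in> Q \<or> c \<in> Q" if "a \<in> R" "c \<in> R" "a * c \<in> Q" for a c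
      using primeideal.I_prime[OF Q(1), of a c] that by simp
    \<comment> \<open>Otherwise \<open>p * (\<pi> * x) = (p * x) * \<pi>\<close> is in
      \<open>Q\<close> for each \<open>p\<close> in \<open>P\<close>, and \<open>\<pi> * x\<close>
      is not even in \<open>P\<close>, so \<open>Q\<close> would be all of \<open>P\<close>.\<close>
    have "\<pi> \<notin> Q"
    proof
      assume "\<pi> \<in> Q"
      have "p \<in> Q" if "p \<in> P" for p
      proof -
        have "(p * x) * \<pi> \<in> Q"
          using that \<open>\<pi> \<in> Q\<close> QR(2) by (simp add: P)
        then have "p * (\<pi> * x) \<in> Q"
          by (simp add: mult_ac)
        then show ?thesis
          using Q_prime[of p "\<pi> * x"] \<pi>R \<pi>(2) that Q(2) by (auto simp: P)
      qed
      then show False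
        using Q(2) by blast
    qed
    have stable: "a * x \<in> Q" if "a \<in> Q" for a
    proof -
      have "a * x \<in> R"
        using that Q(2) by (auto simp: P)
      moreover have "\<pi> * (a * x) \<in> Q"
        using QR(2)[OF \<pi>R(2) that] by (simp add: mult_ac)
      ultimately show ?thesis
        using Q_prime[of \<pi> "a * x"] \<pi>R \<open>\<pi> \<notin> Q\<close> by blast
    qed
    show "Q = {0}"
    proof (rule ccontr)
      assume "Q \<noteq> {0}"
      then obtain q where "q \<in> Q" "q \<noteq> 0"
        using QR(3) by blast
      then show False
        using in_R_if_stable_subset[OF QR(1) _ _ stable] x by blast
    qed
  qed
  then show ?thesis
    using that[of P r] prime r P by (simp add: x_def)
qed

end

section \<open>The starfish argument\<close>

text \<open>A vanishing variable would satisfy the polynomial relation given by that variable alone;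
  \<open>sc 1 1 = 1\<close> evaluates its coefficient.\<close>

lemma seed_var_nonzero:
  assumes "is_seed sc n m S" "sc 1 1 = 1" "i \<in> {1..n+m}"
  shows "xvar S i \<noteq> 0"
proof
  assume x: "xvar S i = 0"
  let ?p = "Poly_Mapping.single (Poly_Mapping.single i 1) 1 :: (nat \<Rightarrow>\<^sub>0 nat) \<Rightarrow>\<^sub>0 complex"
  have "eval_mpoly sc (xvar S) ?p = 0"
    by (simp add: eval_mpoly_def assms(2) x)
  moreover have "\<forall>u\<in>Poly_Mapping.keys ?p. Poly_Mapping.keys u \<subseteq> {1..n+m}"
    using assms(3) by simp
  ultimately have "?p = 0"
    using assms(1) unfolding is_seed_def alg_independent_def by blast
  then have "Poly_Mapping.keys ?p = {}"
    by simp
  then show False by simp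
qed

text \<open>The value 1 outside \<open>{1..N}\<close> makes all coordinates of the evaluation point
  nonzero.\<close>

definition initial_vars :: "nat \<Rightarrow> 'k::field seed \<Rightarrow> nat \<Rightarrow> 'k" where
  "initial_vars N S i = (if i \<in> {1..N} then xvar S i else 1)"

section \<open>Seed patterns as iterated mutations\<close>

lemma lab_edge:
  assumes "labeled_regular_tree n V E lab" "{t, u} \<in> E"
  shows "t \<in> V" "u \<in> V" "lab {t, u} \<in> {1..n}"
proof -
  obtain a c where "a \<in> V" "c \<in> V" "{t, u} = {a, c}"
    using assms unfolding labeled_regular_tree_def tree_graph_def simple_graph_def by metis
  then show V: "t \<in> V" "u \<in> V"
    by (metis doubleton_eq_iff)+
  then have "bij_betw lab {e \<in> E. t \<in> e} {1..n}"
    using assms(1) unfolding labeled_regular_tree_def by blast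
  then show "lab {t, u} \<in> {1..n}"
    using assms(2) by (auto dest: bij_betwE)
qed

lemma nat_max_0: "nat (max a 0) = nat a"
  by (simp add: max_def)

text \<open>Links the relation \<open>seed_mutation\<close>, which speaks only of the relevant
  indices, with the functions for iterated mutation; \<open>ks\<close> lists the labels of the path.
  Nonvanishing along prefixes is recorded for the specialization of Laurent formulas.\<close>

lemma seed_pattern_vars_along:
  assumes tree: "labeled_regular_tree n V E lab" and pat: "seed_pattern sc n m V E lab S"
    and sc1: "sc 1 1 = 1" and t0: "t0 \<in> V"
    and path: "(t0, t) \<in> {(a, b). {a, b} \<in> E}\<^sup>*"
  shows "\<exists>ks. set ks \<subseteq> {1..n} \<and> t \<in> V \<and>
    (\<forall>i\<in>{1..n+m}. \<forall>j\<in>{1..n}. bmat (S t) i j = matrix_along (bmat (S t0)) ks i j) \<and>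
    (\<forall>i\<in>{1..n+m}. xvar (S t) i = vars_along (n + m) (bmat (S t0)) (initial_vars (n + m) (S t0)) ks i) \<and>
    (\<forall>s\<le>length ks. \<forall>i\<in>{1..n+m}.
       vars_along (n + m) (bmat (S t0)) (initial_vars (n + m) (S t0)) (take s ks) i \<noteq> 0)"
  using path
proof (induction rule: rtrancl_induct)
  case base
  have "xvar (S t0) i \<noteq> 0" if "i \<in> {1..n+m}" for i
    using seed_var_nonzero[of sc n m, OF _ sc1 that] pat t0 unfolding seed_pattern_def by blast
  then show ?case
    using t0 by (intro exI[of _ "[]"]) (auto simp: initial_vars_def)
next
  case (step t u)
  let ?N = "n + m"
  let ?vars_along = "vars_along ?N (bmat (S t0)) (initial_vars ?N (S t0))"
  obtain ks where ks: "set ks \<subseteq> {1..n}" "t \<in> V"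
    and B: "\<And>i j. i \<in> {1..?N} \<Longrightarrow> j \<in> {1..n} \<Longrightarrow> bmat (S t) i j = matrix_along (bmat (S t0)) ks i j"
    and x: "\<And>i. i \<in> {1..?N} \<Longrightarrow> xvar (S t) i = ?vars_along ks i"
    and nz: "\<And>s i. s \<le> length ks \<Longrightarrow> i \<in> {1..?N} \<Longrightarrow> ?vars_along (take s ks) i \<noteq> 0"
    using step.IH by blast
  define k where "k = lab {t, u}"
  have tu: "{t, u} \<in> E"
    using step.hyps by simp
  have u: "u \<in> V" and k: "k \<in> {1..n}" "k \<in> {1..?N}"
    using lab_edge[OF tree tu] by (auto simp: k_def)
  have "seed_mutation n m k (S t) (S u)"
    using pat tu ks(2) u unfolding seed_pattern_def k_def by blast
  then have mB: "\<And>i j. i \<in> {1..?N} \<Longrightarrow> j \<in> {1..n} \<Longrightarrow> bmat (S u) i j = mutated_entry (bmat (S t)) k i j"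
    and mx: "\<And>i. i \<in> {1..?N} \<Longrightarrow> i \<noteq> k \<Longrightarrow> xvar (S u) i = xvar (S t) i"
    and mk: "xvar (S t) k * xvar (S u) k = exchange_binomial ?N (bmat (S t)) k (xvar (S t))"
    by (auto simp: seed_mutation_def exchange_binomial_def nat_max_0)
  have xk: "xvar (S t) k \<noteq> 0"
    using nz[of "length ks" k] x k by simp
  have e: "exchange_binomial ?N (bmat (S t)) k (xvar (S t)) =
      exchange_binomial ?N (matrix_along (bmat (S t0)) ks) k (?vars_along ks)"
    by (rule exchange_binomial_cong) (use B k x in auto)
  have xu: "xvar (S u) i = ?vars_along (ks @ [k]) i" if i: "i \<in> {1..?N}" for i
  proof (cases "i = k")
    case True
    have "xvar (S u) k = exchange_binomial ?N (bmat (S t)) k (xvar (S t)) / xvar (S t) k"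
      using mk xk by (simp add: field_simps)
    then show ?thesis
      using True x[OF k(2)] by (simp add: vars_along_snoc mutated_vars_def e)
  next
    case False
    then show ?thesis
      using mx[OF i] x[OF i] by (simp add: vars_along_snoc mutated_vars_def)
  qed
  have Bu: "bmat (S u) i j = matrix_along (bmat (S t0)) (ks @ [k]) i j" if "i \<in> {1..?N}" "j \<in> {1..n}" for i j
    using mB[OF that] B[OF that] B[OF that(1) k(1)] B[OF k(2) that(2)]
    by (simp add: matrix_along_snoc mutated_entry_def)
  have nzu: "?vars_along (take s (ks @ [k])) i \<noteq> 0" if "s \<le> length (ks @ [k])" "i \<in> {1..?N}" for s i
  proof (cases "s \<le> length ks")
    case True
    then show ?thesis
      using nz[OF True that(2)] by simp
  next
    case False
    then have "take s (ks @ [k]) = ks @ [k]"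
      using that by simp
    then show ?thesis
      using xu[OF that(2)] seed_var_nonzero[of sc n m "S u", OF _ sc1 that(2)] pat u
      unfolding seed_pattern_def by auto
  qed
  show ?case
    using ks k u xu Bu nzu by (intro exI[of _ "ks @ [k]"]) auto
qed

lemma cluster_variable_laurent:
  assumes tree: "labeled_regular_tree n V E lab" and pat: "seed_pattern sc n m V E lab S"
    and sc1: "sc 1 1 = 1" and t: "t0 \<in> V" "t \<in> V" and i: "i \<in> {1..n+m}"
  shows "\<exists>G\<in>partial_laurent n. xvar (S t) i = laurent_eval (initial_vars (n + m) (S t0)) G"
proof -
  let ?N = "n + m" and ?b = "bmat (S t0)" and ?x = "initial_vars (n + m) (S t0)"
  have "(t0, t) \<in> {(a, b). {a, b} \<in> E}\<^sup>*"
    using tree t unfolding labeled_regular_tree_def tree_graph_def connected_graph_def by blast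
  from seed_pattern_vars_along[OF tree pat sc1 t(1) this] obtain ks where ks: "set ks \<subseteq> {1..n}"
    and x: "xvar (S t) i = vars_along ?N ?b ?x ks i"
    and nz: "\<And>s i. s \<le> length ks \<Longrightarrow> i \<in> {1..?N} \<Longrightarrow> vars_along ?N ?b ?x (take s ks) i \<noteq> 0"
    using i by blast
  have seed: "is_seed sc n m (S t0)"
    using pat t(1) unfolding seed_pattern_def by blast
  then have L: "laurent_along n ?N ?b l" if "set l \<subseteq> {1..n}" for l
    using that unfolding is_seed_def by (intro laurent_phenomenon) auto
  obtain G where G: "\<And>i. i \<in> {1..?N} \<Longrightarrow> vars_along ?N ?b (\<lambda>i. lfr (lvar i)) ks i = lfr (G i)"
    and Gi: "\<And>i. i \<in> {1..?N} \<Longrightarrow> G i \<in> partial_laurent n"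
    using L[OF ks] unfolding laurent_along_def image_iff by metis
  have "vars_along ?N ?b ?x ks i = laurent_eval ?x (G i)"
  proof (rule laurent_along_transport[OF _ ks])
    show "?x i \<noteq> 0" for i
      using seed_var_nonzero[of sc n m, OF seed sc1] by (simp add: initial_vars_def)
    show "laurent_along n ?N ?b (take s ks)" for s
      using ks set_take_subset[of s ks] by (intro L) blast
  qed (use nz G i in auto)
  then show ?thesis
    using x Gi[OF i] by auto
qed

text \<open>The starfish argument: if every seed of the nerve had a cluster variable in \<open>P\<close>, coprimality
  would keep its index constant along the nerve, so edges with that label could not occur.\<close>

lemma nerve_vertex_avoiding_prime:
  assumes tree: "labeled_regular_tree n V E lab" and nerve: "nerve n V E lab W F"
    and pat: "seed_pattern sc n m V E lab S"
    and vertex: "\<And>t i j. t \<in> W \<Longrightarrow> i \<in> {1..n} \<Longrightarrow> j \<in> {1..n} \<Longrightarrow> i \<noteq> j \<Longrightarrow>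
           \<not> (xvar (S t) i \<in> P \<and> xvar (S t) j \<in> P)"
    and edge: "\<And>t t' k. {t, t'} \<in> F \<Longrightarrow> lab {t, t'} = k \<Longrightarrow>
           \<not> (xvar (S t) k \<in> P \<and> xvar (S t') k \<in> P)"
  shows "\<exists>t\<in>W. \<forall>i\<in>{1..n}. xvar (S t) i \<notin> P"
proof (rule ccontr)
  assume "\<not> ?thesis"
  then have ex: "\<And>t. t \<in> W \<Longrightarrow> \<exists>i\<in>{1..n}. xvar (S t) i \<in> P"
    by blast
  have F: "F \<subseteq> E" "connected_graph W F" "simple_graph W F" "\<forall>k\<in>{1..n}. \<exists>e\<in>F. lab e = k"
    using nerve unfolding nerve_def by blast+
  obtain t1 where t1: "t1 \<in> W"
    using F(2) unfolding connected_graph_def by blast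
  obtain k where k: "k \<in> {1..n}" "xvar (S t1) k \<in> P"
    using ex[OF t1] by blast
  have ends: "t \<in> W \<and> u \<in> W" if "{t, u} \<in> F" for t u
  proof -
    obtain a c where "a \<in> W" "c \<in> W" "{t, u} = {a, c}"
      using F(3) \<open>{t, u} \<in> F\<close> unfolding simple_graph_def by metis
    then show ?thesis
      by (metis doubleton_eq_iff)
  qed
  have const: "xvar (S t) k \<in> P" if "(t1, t) \<in> {(a, b). {a, b} \<in> F}\<^sup>*" for t
    using that
  proof (induction rule: rtrancl_induct)
    case (step t u)
    define l where "l = lab {t, u}"
    have tu: "{t, u} \<in> F" using step.hyps by simp
    have W: "t \<in> W" "u \<in> W" using ends[OF tu] by auto
    have "{t, u} \<in> E" using tu F(1) by blast
    then have "seed_mutation n m l (S t) (S u)"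
      using pat lab_edge(1,2)[OF tree] unfolding seed_pattern_def l_def by blast
    then have "\<forall>i\<in>{1..n+m}. i \<noteq> l \<longrightarrow> xvar (S u) i = xvar (S t) i"
      unfolding seed_mutation_def by (elim conjE)
    then have same: "xvar (S u) i = xvar (S t) i" if "i \<in> {1..n}" "i \<noteq> l" for i
      using that by simp
    \<comment> \<open>On an edge labeled \<open>k\<close>, edge coprimality forces the variable of
      \<open>u\<close> in \<open>P\<close> to have another index \<open>i\<close>. The seed at
      \<open>t\<close> shares it, against coprimality at \<open>t\<close>.\<close>
    have "l \<noteq> k"
    proof
      assume "l = k"
      obtain i where i: "i \<in> {1..n}" "xvar (S u) i \<in> P"
        using ex[OF W(2)] by blast
      show False
        using edge[OF tu l_def[symmetric]] vertex[OF W(1) i(1) k(1)] i step.IH same[OF i(1)]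
        unfolding \<open>l = k\<close> by metis
    qed
    then show ?case
      using same[OF k(1)] step.IH by simp
  qed (rule k(2))
  \<comment> \<open>A nerve has an edge labeled \<open>k\<close>; both ends have their
    \<open>k\<close>-th variable in \<open>P\<close>, against coprimality along the edge.\<close>
  obtain e where e: "e \<in> F" "lab e = k"
    using F(4) k(1) by blast
  obtain u v where uv: "u \<in> W" "v \<in> W" "e = {u, v}"
    using F(3) e(1) unfolding simple_graph_def by blast
  have "xvar (S u) k \<in> P" "xvar (S v) k \<in> P"
    using F(2) t1 uv unfolding connected_graph_def by (auto intro: const)
  then show False
    using edge[of u v k] e uv by blast
qed

section \<open>Cluster variables belong to the ring\<close>

context noetherian_normal
begin

lemma sc_one: "sc 1 1 = 1"
  using smult_one[of 1] one_in by (simp add: ring_of_type_algebra_def)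

lemma sc_in: "sc c 1 \<in> R"
  using smult_closed[of c 1] one_in by (simp add: ring_of_type_algebra_def)

lemma cluster_variable_in_R:
  assumes tree: "labeled_regular_tree n V E lab" and nerve: "nerve n V E lab W F"
    and pat: "seed_pattern sc n m V E lab S"
    and frozen: "frozen_vars n m V S \<subseteq> R" and cluster: "\<And>t. t \<in> W \<Longrightarrow> cluster n (S t) \<subseteq> R"
    and vertex: "\<And>t i j. t \<in> W \<Longrightarrow> i \<in> {1..n} \<Longrightarrow> j \<in> {1..n} \<Longrightarrow> i \<noteq> j \<Longrightarrow>
           coprime_in A (xvar (S t) i) (xvar (S t) j)"
    and edge: "\<And>t t' k. {t, t'} \<in> F \<Longrightarrow> lab {t, t'} = k \<Longrightarrow>
           coprime_in A (xvar (S t) k) (xvar (S t') k)"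
    and t: "t \<in> V" and i: "i \<in> {1..n}"
  shows "xvar (S t) i \<in> R"
proof (rule ccontr)
  let ?y = "xvar (S t) i"
  assume "?y \<notin> R"
  then obtain P r where P: "primeideal P A" "prime_height A P = 1"
    and r: "r \<in> R" "P = {s \<in> R. s * (r * ?y) \<in> R}"
    by (rule height_one_denominator)
  have "\<exists>t\<in>W. \<forall>i\<in>{1..n}. xvar (S t) i \<notin> P"
    by (rule nerve_vertex_avoiding_prime[OF tree nerve pat])
      (use vertex edge P in \<open>unfold coprime_in_def, blast+\<close>)
  then obtain t0 where t0: "t0 \<in> W" and avoid: "\<And>i. i \<in> {1..n} \<Longrightarrow> xvar (S t0) i \<notin> P"
    by blast
  have t0V: "t0 \<in> V"
    using nerve t0 unfolding nerve_def by blast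
  let ?x = "initial_vars (n + m) (S t0)"
  obtain G where G: "G \<in> partial_laurent n" "?y = laurent_eval ?x G"
    using cluster_variable_laurent[OF tree pat sc_one t0V t] i by force
  have xR: "?x i \<in> R" for i
  proof -
    consider "i \<notin> {1..n+m}" | "i \<in> {1..n}" | "i \<in> {n+1..n+m}" by force
    then show ?thesis
    proof cases
      case 1
      then show ?thesis by (simp only: initial_vars_def one_in if_False)
    next
      case 2
      then show ?thesis
        using cluster[OF t0] by (auto simp: initial_vars_def cluster_def)
    next
      case 3
      then have "xvar (S t0) i \<in> frozen_vars n m V S"
        unfolding frozen_vars_def using t0V by blast
      then show ?thesis
        using frozen 3 by (auto simp: initial_vars_def)
    qed
  qed
  have x0: "?x i \<noteq> 0" for i
    using seed_var_nonzero[of sc n m, OF _ sc_one] pat t0V unfolding seed_pattern_def initial_vars_def by auto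
  \<comment> \<open>Only mutable variables enter \<open>d\<close>, since the strong Laurent
    phenomenon leaves no frozen denominators to clear.\<close>
  define d where "d = (\<Prod>i\<in>{1..n}. ?x i)"
  have dR: "d \<in> R"
    unfolding d_def by (rule prod_in) (rule xR)
  have "\<exists>a. d ^ a * laurent_eval ?x G \<in> R"
  proof (rule clear_laurent_eval[OF xR x0 dR _ G(1)])
    show "d / ?x i \<in> R" if "i \<le> n" for i
    \<comment> \<open>Index 0 is at most \<open>n\<close> but not a factor of \<open>d\<close>;
      \<open>initial_vars\<close> is 1 there.\<close>
    proof (cases "i = 0")
      case True
      then show ?thesis
        using dR by (simp add: initial_vars_def)
    next
      case False
      then have "d = ?x i * (\<Prod>i\<in>{1..n} - {i}. ?x i)"
        unfolding d_def using that by (intro prod.remove) auto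
      then have "d / ?x i = (\<Prod>i\<in>{1..n} - {i}. ?x i)"
        using x0[of i] by (simp add: field_simps)
      then show ?thesis
        using prod_in[of "{1..n} - {i}" ?x] xR by simp
    qed
  qed
  then obtain a where a: "d ^ a * ?y \<in> R"
    unfolding G(2) by blast
  \<comment> \<open>So \<open>d ^ a\<close> is a denominator of \<open>r * ?y\<close>, that is, an
    element of \<open>P\<close>; primality then places some cluster variable of \<open>S t0\<close>
    in \<open>P\<close>.\<close>
  have "r * (d ^ a * ?y) \<in> R"
    by (rule mult_in[OF r(1) a])
  then have "d ^ a \<in> P"
    using dR by (simp add: r(2) power_in mult.left_commute)
  have one_notin: "1 \<notin> P"
    using primeideal.I_notcarr[OF P(1)] ideal_alg_ofD[OF primeideal.axioms(1)[OF P(1)]]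
    by (force simp: mult.commute)
  have prime: "u \<in> P \<or> v \<in> P" if "u \<in> R" "v \<in> R" "u * v \<in> P" for u v
    using primeideal.I_prime[OF P(1), of u v] that by simp
  have "d \<in> P"
    using \<open>d ^ a \<in> P\<close>
  proof (induction a)
    case (Suc a)
    then show ?case
      using prime[of d "d ^ a"] dR power_in by auto
  qed (use one_notin in simp)
  moreover have "(\<Prod>i\<in>B. ?x i) \<in> P \<Longrightarrow> \<exists>i\<in>B. ?x i \<in> P" if "finite B" for B
    using that
  proof (induction B rule: finite_induct)
    case (insert j B)
    then show ?case
      using prime[of "?x j" "\<Prod>i\<in>B. ?x i"] xR prod_in[of B ?x] by auto
  qed (use one_notin in simp)
  ultimately obtain j where "j \<in> {1..n}" "?x j \<in> P"
    unfolding d_def by blast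
  then show False
    using avoid[of j] by (simp add: initial_vars_def)
qed

end

lemma a_inv_ring_of_type_algebra: "\<ominus>\<^bsub>ring_of_type_algebra\<^esub> (h :: 'k::field) = - h"
proof -
  interpret ring "ring_of_type_algebra :: 'k ring"
    by (rule ring_from_type_algebra)
  have "h + (\<ominus>\<^bsub>ring_of_type_algebra\<^esub> h) = 0"
    using r_neg[of h] by (simp add: ring_of_type_algebra_def)
  then show ?thesis
    by (simp add: add_eq_0_iff)
qed

theorem proposition9p1:
  fixes n m :: nat
    and V W :: "'v set" and E F :: "'v set set" and lab :: "'v set \<Rightarrow> nat"
    and R :: "'k::field set" and sc :: "complex \<Rightarrow> 'k \<Rightarrow> 'k"
    and S :: "'v \<Rightarrow> 'k seed"
  assumes "labeled_regular_tree n V E lab"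
    and "nerve n V E lab W F"
    and "noetherian_normal_domain_algebra R sc"
    and "seed_pattern sc n m V E lab S"
    and "frozen_vars n m V S \<subseteq> R"
    and "\<And>t. t \<in> W \<Longrightarrow> cluster n (S t) \<subseteq> R"
    and "\<And>t i j. t \<in> W \<Longrightarrow> i \<in> {1..n} \<Longrightarrow> j \<in> {1..n} \<Longrightarrow> i \<noteq> j \<Longrightarrow>
           coprime_in (alg_of R sc) (xvar (S t) i) (xvar (S t) j)"
    and "\<And>t t' k. {t, t'} \<in> F \<Longrightarrow> lab {t, t'} = k \<Longrightarrow>
           coprime_in (alg_of R sc) (xvar (S t) k) (xvar (S t') k)"
  shows "cluster_algebra sc n m V S \<subseteq> R"
proof
  interpret noetherian_normal R sc
    by unfold_locales fact
  have cluster: "xvar (S t) i \<in> R" if "t \<in> V" "i \<in> {1..n}" for t i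
    by (rule cluster_variable_in_R[OF assms(1,2,4-8) that])
  fix y
  assume "y \<in> cluster_algebra sc n m V S"
  then show "y \<in> R"
    unfolding cluster_algebra_def
  proof (induction rule: generate_ring.induct)
    case one
    then show ?case
      using one_in by (simp add: ring_of_type_algebra_def)
  next
    case (incl h)
    then show ?case
      using sc_in assms(5) cluster by (auto simp: cluster_def)
  next
    case (a_inv h)
    then show ?case
      by (simp add: a_inv_ring_of_type_algebra uminus_in)
  next
    case (eng_add h1 h2)
    then show ?case
      using add_in by (simp add: ring_of_type_algebra_def)
  next
    case (eng_mult h1 h2)
    then show ?case
      using mult_in by (simp add: ring_of_type_algebra_def)
  qed
qed

end
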